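(* Let $M$ be a complete metric space with a designated origin $0\in M$. If $M$ is unbounded or is not uniformly discrete, then $\mathrm{Lip}_0(M)$ has the symmetric strong diameter two property (SSD2P). In particular, the norm of $\mathcal{F}(M)^{**}$ is octahedral.
   Context: All Banach spaces are real. $B_X$, $S_X$ denote the closed unit ball and unit sphere of a Banach space $X$. For a metric space $(M,d)$ with designated origin $0\in M$, $\mathrm{Lip}_0(M)$ is the Banach space of Lipschitz functions $f:M\to\mathbb{R}$ with $f(0)=0$, with norm $\|f\|=\sup_{x\neq y}\frac{|f(x)-f(y)|}{d(x,y)}$. The Lipschitz-free space is $\mathcal{F}(M)=\overline{\mathrm{span}}\{\delta_m: m\in M\}\subseteq \mathrm{Lip}_0(M)^*$, where $\delta_m(f)=f(m)$; one has $\mathcal{F}(M)^*=\mathrm{Lip}_0(M)$ isometrically, so $\mathcal F(M)^{**}=\mathrm{Lip}_0(M)^*$. $M$ is uniformly discrete if $\inf_{x\neq y}d(x,y)>0$. A slice of $B_X$ is a set $S(B_X,f,\alpha)=\{x\in B_X: f(x)>1-\alpha\}$ with $f\in S_{X^*}$, $\alpha>0$. $X$ has the SSD2P if for every $k\in\mathbb{N}$, all slices $S_1,\dots,S_k$ of $B_X$ and every $\varepsilon>0$, there are $x_i\in S_i$ and $\varphi\in B_X$ with $\|\varphi\|>1-\varepsilon$ such that $x_i\pm\varphi\in S_i$ for every $i\in\{1,\dots,k\}$. The norm of $X$ is octahedral if for every finite-dimensional subspace $Y$ of $X$ and every $\varepsilon>0$ there is $x\in S_X$ such that $\|y+\lambda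 x\|\geq(1-\varepsilon)(\|y\|+|\lambda|)$ for all $y\in Y$, $\lambda\in\mathbb{R}$. *)

theory Defs
  imports "HOL-Analysis.Analysis"
begin

class pointed_metric_space = metric_space +
  fixes origin :: 'a

typedef (overloaded) 'a lip0 =
  "{f :: 'a::pointed_metric_space \<Rightarrow> real. (\<exists>L. L-lipschitz_on UNIV f) \<and> f origin = 0}"
  morphisms apply_lip0 Abs_lip0
  by (rule exI[of _ "\<lambda>_. 0"]) (auto intro: lipschitz_on_constant)

setup_lifting type_definition_lip0

text \<open>The supremum ranges over all pairs. Because \<open>t / 0 = 0\<close>, the diagonal contributes only the
  value 0, which does not change the supremum over \<open>x \<noteq> y\<close> and gives the norm 0 when the
  space is a single point.\<close>

definition lip_norm :: "('a::metric_space \<Rightarrow> real) \<Rightarrow> real" where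
  "lip_norm f = (SUP (x, y). \<bar>f x - f y\<bar> / dist x y)"

lemma lip_norm_bdd:
  assumes "\<exists>L. L-lipschitz_on UNIV f"
  shows "bdd_above (range (\<lambda>(x, y). \<bar>f x - f y\<bar> / dist x y :: real))"
proof -
  obtain L where L: "L-lipschitz_on UNIV f" using assms by blast
  have "\<bar>f x - f y\<bar> / dist x y \<le> L" for x y
    using lipschitz_onD[OF L, of x y] lipschitz_on_nonneg[OF L]
    by (cases "x = y") (auto simp: dist_real_def divide_le_eq)
  then show ?thesis by (auto intro!: bdd_aboveI[of _ L])
qed

lemma lip_norm_upper:
  assumes "\<exists>L. L-lipschitz_on UNIV f"
  shows "\<bar>f x - f y\<bar> \<le> lip_norm f * dist x y"
proof (cases "x = y")
  case False
  have "\<bar>f x - f y\<bar> / dist x y \<le> lip_norm f"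
    unfolding lip_norm_def using cSUP_upper[OF _ lip_norm_bdd[OF assms], of "(x, y)"] by simp
  with False show ?thesis by (simp add: divide_le_eq)
qed simp

lemma lip_norm_least:
  assumes "\<And>x y. \<bar>f x - f y\<bar> \<le> c * dist x y" and "0 \<le> c"
  shows "lip_norm f \<le> c"
  unfolding lip_norm_def
proof (rule cSUP_least, simp, clarify)
  fix x y show "\<bar>f x - f y\<bar> / dist x y \<le> c"
    using assms by (cases "x = y") (auto simp: divide_le_eq)
qed

lemma lip_norm_nonneg:
  assumes "\<exists>L. L-lipschitz_on UNIV f"
  shows "0 \<le> lip_norm f"
  unfolding lip_norm_def using cSUP_upper[OF _ lip_norm_bdd[OF assms], of "(undefined, undefined)"]
  by simp

lemma lip_norm_scaleR_le:
  assumes "\<exists>L. L-lipschitz_on UNIV f"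
  shows "lip_norm (\<lambda>x. r * f x) \<le> \<bar>r\<bar> * lip_norm f"
proof (rule lip_norm_least)
  fix x y
  have "\<bar>r * f x - r * f y\<bar> = \<bar>r\<bar> * \<bar>f x - f y\<bar>"
    by (simp add: abs_mult flip: right_diff_distrib)
  also have "\<dots> \<le> \<bar>r\<bar> * (lip_norm f * dist x y)"
    by (intro mult_left_mono lip_norm_upper assms) simp
  finally show "\<bar>r * f x - r * f y\<bar> \<le> \<bar>r\<bar> * lip_norm f * dist x y" by (simp add: mult.assoc)
qed (use lip_norm_nonneg[OF assms] in simp)

lemma lip_norm_scaleR:
  assumes "\<exists>L. L-lipschitz_on UNIV f"
  shows "lip_norm (\<lambda>x. r * f x) = \<bar>r\<bar> * lip_norm f"
proof (cases "r = 0")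
  case True
  then show ?thesis using lip_norm_scaleR_le[OF assms, of r] lip_norm_nonneg[of "\<lambda>x. r * f x"]
    by (auto intro: lipschitz_on_constant)
next
  case False
  have "\<exists>L. L-lipschitz_on UNIV (\<lambda>x. r * f x)"
    using assms lipschitz_on_cmult_real by blast
  from lip_norm_scaleR_le[OF this, of "1 / r"] False
  have "lip_norm f \<le> lip_norm (\<lambda>x. r * f x) / \<bar>r\<bar>" by (simp add: abs_mult)
  with False have "\<bar>r\<bar> * lip_norm f \<le> lip_norm (\<lambda>x. r * f x)"
    by (simp add: le_divide_eq mult.commute)
  with lip_norm_scaleR_le[OF assms, of r] show ?thesis by simp
qed

lemma lip_norm_triangle:
  assumes f: "\<exists>L. L-lipschitz_on UNIV f" and g: "\<exists>L. L-lipschitz_on UNIV g"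
  shows "lip_norm (\<lambda>x. f x + g x) \<le> lip_norm f + lip_norm g"
proof (rule lip_norm_least)
  fix x y
  show "\<bar>f x + g x - (f y + g y)\<bar> \<le> (lip_norm f + lip_norm g) * dist x y"
    using lip_norm_upper[OF f, of x y] lip_norm_upper[OF g, of x y]
    by (simp add: distrib_right)
qed (use lip_norm_nonneg[OF f] lip_norm_nonneg[OF g] in simp)

lemma lip_norm_eq_0:
  assumes "\<exists>L. L-lipschitz_on UNIV f" and "f z = 0"
  shows "lip_norm f = 0 \<longleftrightarrow> f = (\<lambda>_. 0)"
proof
  assume "lip_norm f = 0"
  then show "f = (\<lambda>_. 0)" using lip_norm_upper[OF assms(1), of _ z] assms(2) by auto
next
  assume "f = (\<lambda>_. 0)"
  then show "lip_norm f = 0"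
    using lip_norm_least[of f 0] lip_norm_nonneg[OF assms(1)] by simp
qed

instantiation lip0 :: (pointed_metric_space) real_normed_vector
begin

lift_definition norm_lip0 :: "'a lip0 \<Rightarrow> real" is lip_norm .

lift_definition zero_lip0 :: "'a lip0" is "\<lambda>_. 0"
  by (auto intro: lipschitz_on_constant)

lift_definition plus_lip0 :: "'a lip0 \<Rightarrow> 'a lip0 \<Rightarrow> 'a lip0" is "\<lambda>f g x. f x + g x"
  using lipschitz_on_add by fastforce

lift_definition minus_lip0 :: "'a lip0 \<Rightarrow> 'a lip0 \<Rightarrow> 'a lip0" is "\<lambda>f g x. f x - g x"
  using lipschitz_on_diff by fastforce

lift_definition uminus_lip0 :: "'a lip0 \<Rightarrow> 'a lip0" is "\<lambda>f x. - f x"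
  by auto

lift_definition scaleR_lip0 :: "real \<Rightarrow> 'a lip0 \<Rightarrow> 'a lip0" is "\<lambda>r f x. r * f x"
  using lipschitz_on_cmult_real by fastforce

definition dist_lip0 :: "'a lip0 \<Rightarrow> 'a lip0 \<Rightarrow> real"
  where "dist_lip0 f g = norm (f - g)"

definition sgn_lip0 :: "'a lip0 \<Rightarrow> 'a lip0"
  where "sgn_lip0 f = inverse (norm f) *\<^sub>R f"

definition uniformity_lip0 :: "('a lip0 \<times> 'a lip0) filter"
  where "uniformity_lip0 = (INF e\<in>{0<..}. principal {(x, y). dist x y < e})"

definition open_lip0 :: "'a lip0 set \<Rightarrow> bool"
  where "open_lip0 S = (\<forall>x\<in>S. \<forall>\<^sub>F (x', y) in uniformity. x' = x \<longrightarrow> y \<in> S)"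

instance
proof
  fix f g h :: "'a lip0" and r s :: real
  show "f + g + h = f + (g + h)" "f + g = g + f" "0 + f = f" "- f + f = 0" "f - g = f + - g"
    "r *\<^sub>R (f + g) = r *\<^sub>R f + r *\<^sub>R g" "(r + s) *\<^sub>R f = r *\<^sub>R f + s *\<^sub>R f"
    "r *\<^sub>R s *\<^sub>R f = (r * s) *\<^sub>R f" "1 *\<^sub>R f = f"
    by (transfer; simp add: algebra_simps)+
  show "norm f = 0 \<longleftrightarrow> f = 0" by transfer (use lip_norm_eq_0[where z = origin] in blast)
  show "norm (f + g) \<le> norm f + norm g" by transfer (auto intro: lip_norm_triangle)
  show "norm (r *\<^sub>R f) = \<bar>r\<bar> * norm f" by transfer (auto intro: lip_norm_scaleR)
qed (simp_all add: dist_lip0_def sgn_lip0_def uniformity_lip0_def open_lip0_def)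

end

lift_definition delta :: "'a::pointed_metric_space \<Rightarrow> 'a lip0 \<Rightarrow>\<^sub>L real" is "\<lambda>m f. apply_lip0 f m"
proof (rule bounded_linear_intro)
  fix m :: 'a and f g :: "'a lip0" and r :: real
  show "apply_lip0 (f + g) m = apply_lip0 f m + apply_lip0 g m" by transfer simp
  show "apply_lip0 (r *\<^sub>R f) m = r *\<^sub>R apply_lip0 f m" by transfer simp
  show "norm (apply_lip0 f m) \<le> norm f * dist m origin"
    by transfer (use lip_norm_upper[where y = origin] in fastforce)
qed

typedef (overloaded) 'a lipfree =
  "closure (span (range (delta :: 'a::pointed_metric_space \<Rightarrow> 'a lip0 \<Rightarrow>\<^sub>L real)))"
  morphisms dual_of_lipfree Abs_lipfree
  by (rule exI[of _ 0]) (use closure_subset span_zero in blast)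

setup_lifting type_definition_lipfree

lemma subspace_closure:
  fixes S :: "'b::real_normed_vector set"
  assumes "subspace S"
  shows "subspace (closure S)"
  unfolding subspace_def
proof (intro conjI ballI allI)
  show "0 \<in> closure S"
    using subspace_0[OF assms] closure_subset by blast
next
  fix x y assume "x \<in> closure S" "y \<in> closure S"
  then obtain f g where "\<And>n. f n \<in> S" "f \<longlonglongrightarrow> x" "\<And>n. g n \<in> S" "g \<longlonglongrightarrow> y"
    unfolding closure_sequential by blast
  then show "x + y \<in> closure S"
    unfolding closure_sequential
    by (intro exI[of _ "\<lambda>n. f n + g n"]) (auto intro: tendsto_add subspace_add[OF assms])
next
  fix c :: real and x assume "x \<in> closure S"
  then obtain f where "\<And>n. f n \<in> S" "f \<longlonglongrightarrow> x"
    unfolding closure_sequential by blast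
  then show "c *\<^sub>R x \<in> closure S"
    unfolding closure_sequential
    by (intro exI[of _ "\<lambda>n. c *\<^sub>R f n"]) (auto intro: tendsto_intros subspace_scale[OF assms])
qed

lemma subspace_lipfree: "subspace (closure (span (range delta)))"
  by (intro subspace_closure subspace_span)

instantiation lipfree :: (pointed_metric_space) real_normed_vector
begin

lift_definition norm_lipfree :: "'a lipfree \<Rightarrow> real" is norm .

lift_definition zero_lipfree :: "'a lipfree" is 0
  by (rule subspace_0[OF subspace_lipfree])

lift_definition plus_lipfree :: "'a lipfree \<Rightarrow> 'a lipfree \<Rightarrow> 'a lipfree" is "(+)"
  by (rule subspace_add[OF subspace_lipfree])

lift_definition minus_lipfree :: "'a lipfree \<Rightarrow> 'a lipfree \<Rightarrow> 'a lipfree" is "(-)"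
  by (rule subspace_diff[OF subspace_lipfree])

lift_definition uminus_lipfree :: "'a lipfree \<Rightarrow> 'a lipfree" is uminus
  by (rule subspace_neg[OF subspace_lipfree])

lift_definition scaleR_lipfree :: "real \<Rightarrow> 'a lipfree \<Rightarrow> 'a lipfree" is "(*\<^sub>R)"
  by (rule subspace_scale[OF subspace_lipfree])

definition dist_lipfree :: "'a lipfree \<Rightarrow> 'a lipfree \<Rightarrow> real"
  where "dist_lipfree u v = norm (u - v)"

definition sgn_lipfree :: "'a lipfree \<Rightarrow> 'a lipfree"
  where "sgn_lipfree u = inverse (norm u) *\<^sub>R u"

definition uniformity_lipfree :: "('a lipfree \<times> 'a lipfree) filter"
  where "uniformity_lipfree = (INF e\<in>{0<..}. principal {(x, y). dist x y < e})"

definition open_lipfree :: "'a lipfree set \<Rightarrow> bool"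
  where "open_lipfree S = (\<forall>x\<in>S. \<forall>\<^sub>F (x', y) in uniformity. x' = x \<longrightarrow> y \<in> S)"

instance
proof
  fix u v w :: "'a lipfree" and r s :: real
  show "u + v + w = u + (v + w)" "u + v = v + u" "0 + u = u" "- u + u = 0" "u - v = u + - v"
    "r *\<^sub>R (u + v) = r *\<^sub>R u + r *\<^sub>R v" "(r + s) *\<^sub>R u = r *\<^sub>R u + s *\<^sub>R u"
    "r *\<^sub>R s *\<^sub>R u = (r * s) *\<^sub>R u" "1 *\<^sub>R u = u"
    by (transfer; simp add: algebra_simps)+
  show "norm u = 0 \<longleftrightarrow> u = 0" by transfer simp
  show "norm (u + v) \<le> norm u + norm v" by transfer (rule norm_triangle_ineq)
  show "norm (r *\<^sub>R u) = \<bar>r\<bar> * norm u" by transfer simp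
qed (simp_all add: dist_lipfree_def sgn_lipfree_def uniformity_lipfree_def open_lipfree_def)

end

definition slice :: "('x::real_normed_vector \<Rightarrow>\<^sub>L real) \<Rightarrow> real \<Rightarrow> 'x set" where
  "slice f \<alpha> = {x \<in> cball 0 1. blinfun_apply f x > 1 - \<alpha>}"

definition is_slice :: "'x::real_normed_vector set \<Rightarrow> bool" where
  "is_slice S \<longleftrightarrow> (\<exists>f \<alpha>. norm f = 1 \<and> \<alpha> > 0 \<and> S = slice f \<alpha>)"

text \<open>The two properties below concern a normed space, here a type, and not its elements.\<close>

definition SSD2P :: "'x::real_normed_vector itself \<Rightarrow> bool" where
  "SSD2P (_ :: 'x itself) \<longleftrightarrow>
    (\<forall>k\<ge>1. \<forall>S :: nat \<Rightarrow> 'x set. \<forall>\<epsilon>>0. (\<forall>i\<in>{1..k}. is_slice (S i)) \<longrightarrow>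
      (\<exists>x :: nat \<Rightarrow> 'x. \<exists>\<phi> \<in> cball 0 1. norm \<phi> > 1 - \<epsilon> \<and>
        (\<forall>i\<in>{1..k}. x i \<in> S i \<and> x i + \<phi> \<in> S i \<and> x i - \<phi> \<in> S i)))"

definition octahedral :: "'x::real_normed_vector itself \<Rightarrow> bool" where
  "octahedral (_ :: 'x itself) \<longleftrightarrow>
    (\<forall>Y :: 'x set. \<forall>\<epsilon>>0. subspace Y \<and> (\<exists>B. finite B \<and> Y = span B) \<longrightarrow>
      (\<exists>x \<in> sphere 0 1. \<forall>y\<in>Y. \<forall>t :: real. norm (y + t *\<^sub>R x) \<ge> (1 - \<epsilon>) * (norm y + \<bar>t\<bar>)))"

end

theory Submission
  imports Defs
begin

text \<open>Let \<open>f\<^sub>1, \<dots>, f\<^sub>k\<close> be points of the given slices, with norm slightly below 1. To find one \<open>\<phi>\<close> of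
  norm almost 1 that can be added to and subtracted from all of them, one makes the \<open>f\<^sub>i\<close> constant
  on a region of \<open>M\<close> and lets \<open>\<phi>\<close> live well inside that region. The region is an annulus around a
  point \<open>p\<close>, at distance comparable to \<open>s\<close> from \<open>p\<close> but with a large ratio of the outer to the inner
  radius. The largeness of the ratio serves two purposes. The transition between \<open>f\<^sub>i\<close> and the constant
  can follow a cutoff that is linear in \<open>ln (dist x p)\<close>, which costs only an arbitrarily small amount of
  Lipschitz norm, and the points where \<open>f\<^sub>i\<close> has not been made constant are so near to \<open>p\<close> or so far
  from it that there the bump \<open>\<phi>\<close> at scale \<open>s\<close> does not harm the Lipschitz estimate
  (\<open>flatten_plus_tent_lipschitz\<close>).

  The change to \<open>f\<^sub>i\<close> and the bump are both supported in the annulus. Lipschitz functions with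
  pairwise disjoint supports and a common Lipschitz bound have uniformly bounded signed sums, so they tend
  weakly to 0 (\<open>disjoint_supports_weakly_null\<close>). Given infinitely many disjoint annuli, in one of them
  the construction therefore hardly changes the values of the finitely many functionals, and the
  modified functions stay in the slices (\<open>SSD2P_lip0\<close>). The hypothesis on \<open>M\<close> is what gives the annuli
  (\<open>disjoint_annuli\<close>): concentric ones with radii tending to infinity if \<open>M\<close> is unbounded, concentric
  ones with radii tending to 0 around an accumulation point, and otherwise small ones around separated
  points. Keeping the annuli away from their centres matters in the concentric cases:
  flattening on whole balls \<open>B(p, r)\<close> with \<open>r \<rightarrow> 0\<close> would not be weakly negligible, because some
  functionals see the behaviour of \<open>f\<^sub>i\<close> at \<open>p\<close> itself.

  Octahedrality of the dual follows from SSD2P by applying it to the slices given by a finite net of the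
  unit sphere of the finite-dimensional subspace: a functional that almost attains its norm at \<open>\<phi>\<close>
  is almost \<open>\<ell>\<^sub>1\<close>-orthogonal to the net (\<open>SSD2P_imp_dual_octahedral\<close>). This is used in the dual of
  \<open>\<F>(M)\<close>, which is isometric to \<open>Lip\<^sub>0(M)\<close> and in which evaluations at vectors of \<open>\<F>(M)\<close> supply the
  functionals that almost attain their norm.\<close>

section \<open>Flattening a function on an annulus\<close>

text \<open>On a logarithmic scale this function is a trapezoid: it is 1 for \<open>\<bar>ln t\<bar> \<le> ln B\<close> and then
  decreases with slope \<open>\<eta>\<close>. It is set to 0 at \<open>t = 0\<close> separately, since \<open>ln 0 = 0\<close> would put the
  centre of the annulus into the support.\<close>

definition log_cutoff :: "real \<Rightarrow> real \<Rightarrow> real \<Rightarrow> real" where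
  "log_cutoff \<eta> B t = (if t \<le> 0 then 0 else max 0 (min 1 (1 + \<eta> * (ln B - \<bar>ln t\<bar>))))"

lemma log_cutoff_bounds: "0 \<le> log_cutoff \<eta> B t" "log_cutoff \<eta> B t \<le> 1"
  by (auto simp: log_cutoff_def)

lemma log_cutoff_eq_1:
  assumes "\<eta> > 0" "B \<ge> 1" "1 / B \<le> t" "t \<le> B"
  shows "log_cutoff \<eta> B t = 1"
proof -
  have t: "t > 0" using assms by (smt (verit) divide_pos_pos)
  have "ln (1 / B) \<le> ln t" using assms t by (intro ln_mono) auto
  moreover have "ln t \<le> ln B" using assms t by (intro ln_mono) auto
  ultimately have "\<bar>ln t\<bar> \<le> ln B" using assms by (auto simp: ln_div)
  then have "\<eta> * (ln B - \<bar>ln t\<bar>) \<ge> 0" using assms by simp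
  then show ?thesis using t by (auto simp: log_cutoff_def)
qed

lemma log_cutoff_eq_0:
  assumes "\<eta> > 0" "B \<ge> 1" "t \<le> 1 / (B * exp (1 / \<eta>)) \<or> B * exp (1 / \<eta>) \<le> t"
  shows "log_cutoff \<eta> B t = 0"
proof (cases "t \<le> 0")
  case False
  have l: "ln (B * exp (1 / \<eta>)) = ln B + 1 / \<eta>" using assms by (simp add: ln_mult)
  have pos: "B * exp (1 / \<eta>) > 0" using assms by simp
  from assms(3) have "\<bar>ln t\<bar> \<ge> ln B + 1 / \<eta>"
  proof
    assume "t \<le> 1 / (B * exp (1 / \<eta>))"
    then have "ln t \<le> ln (1 / (B * exp (1 / \<eta>)))" using False pos by (intro ln_mono) auto
    also have "\<dots> = - ln (B * exp (1 / \<eta>))"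
      using pos by (subst ln_div) (simp_all del: mult_eq_0_iff zero_less_mult_iff)
    also have "\<dots> = - (ln B + 1 / \<eta>)" using l by simp
    finally show ?thesis by linarith
  next
    assume "B * exp (1 / \<eta>) \<le> t"
    then have "ln (B * exp (1 / \<eta>)) \<le> ln t" using pos by (intro ln_mono) auto
    then show ?thesis using l by linarith
  qed
  then have "\<eta> * (ln B - \<bar>ln t\<bar>) \<le> \<eta> * (- 1 / \<eta>)" using assms by (intro mult_left_mono) auto
  then have "\<eta> * (ln B - \<bar>ln t\<bar>) \<le> - 1" using assms by simp
  then show ?thesis by (simp add: log_cutoff_def)
qed (simp add: log_cutoff_def)

text \<open>The derivative of \<open>\<eta> * ln t\<close> is \<open>\<eta> / t\<close>. The factor \<open>t\<close> on the left is the available bound for the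
  function that the cutoff will multiply, so the product changes only at the small rate \<open>\<eta>\<close>, at
  every scale.\<close>

lemma log_cutoff_slope:
  assumes "\<eta> > 0" "0 \<le> t" "t \<le> t'"
  shows "t * \<bar>log_cutoff \<eta> B t - log_cutoff \<eta> B t'\<bar> \<le> \<eta> * (t' - t)"
proof (cases "t = 0")
  case False
  then have t: "0 < t" "0 < t'" using assms by auto
  have clamp: "\<bar>max 0 (min 1 (1 + a)) - max 0 (min 1 (1 + b))\<bar> \<le> \<bar>a - b\<bar>" for a b :: real
    by linarith
  have "\<bar>log_cutoff \<eta> B t - log_cutoff \<eta> B t'\<bar>
      \<le> \<bar>\<eta> * (ln B - \<bar>ln t\<bar>) - \<eta> * (ln B - \<bar>ln t'\<bar>)\<bar>"
    unfolding log_cutoff_def if_not_P[OF t(1)[unfolded not_le[symmetric]]]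
      if_not_P[OF t(2)[unfolded not_le[symmetric]]] by (rule clamp)
  also have "\<dots> = \<eta> * \<bar>\<bar>ln t'\<bar> - \<bar>ln t\<bar>\<bar>"
    using assms by (simp add: abs_mult flip: right_diff_distrib)
  also have "\<dots> \<le> \<eta> * (ln t' - ln t)"
  proof (rule mult_left_mono)
    have "ln t \<le> ln t'" using assms t by (intro ln_mono) auto
    then show "\<bar>\<bar>ln t'\<bar> - \<bar>ln t\<bar>\<bar> \<le> ln t' - ln t" by linarith
  qed (use assms in simp)
  also have "\<dots> \<le> \<eta> * ((t' - t) / t)"
    using assms t by (intro mult_left_mono ln_diff_le) auto
  finally show ?thesis using t by (simp add: field_simps)
qed (use assms in auto)

definition radial_cutoff :: "real \<Rightarrow> real \<Rightarrow> 'a::metric_space \<Rightarrow> real \<Rightarrow> 'a \<Rightarrow> real" where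
  "radial_cutoff \<eta> B p s x = log_cutoff \<eta> B (dist x p / s)"

lemma radial_cutoff_slope:
  assumes "\<eta> > 0" "s > 0" "dist y p \<le> dist x p"
  shows "dist y p * \<bar>radial_cutoff \<eta> B p s y - radial_cutoff \<eta> B p s x\<bar> \<le> \<eta> * dist x y"
proof -
  have "dist y p / s * \<bar>radial_cutoff \<eta> B p s y - radial_cutoff \<eta> B p s x\<bar>
      \<le> \<eta> * (dist x p / s - dist y p / s)"
    unfolding radial_cutoff_def
    by (rule log_cutoff_slope) (use assms in \<open>auto simp: divide_right_mono\<close>)
  then have "dist y p * \<bar>radial_cutoff \<eta> B p s y - radial_cutoff \<eta> B p s x\<bar>
      \<le> \<eta> * (dist x p - dist y p)"
    using assms by (simp add: field_simps)
  also have "\<dots> \<le> \<eta> * dist x y"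
    using assms dist_triangle[of x p y] by (intro mult_left_mono) (auto simp: dist_commute)
  finally show ?thesis .
qed

text \<open>The constant put in place of \<open>f\<close> is \<open>f p\<close>; after its subtraction the flattened part has the value 0,
  and off the plateau the size is bounded by the distance from \<open>p\<close>.\<close>

definition flatten :: "real \<Rightarrow> real \<Rightarrow> 'a::metric_space \<Rightarrow> real \<Rightarrow> ('a \<Rightarrow> real) \<Rightarrow> 'a \<Rightarrow> real" where
  "flatten \<eta> B p s f x = (1 - radial_cutoff \<eta> B p s x) * (f x - f p)"

text \<open>As a function of \<open>dist x p\<close>, a tent with peak at \<open>s\<close> that starts at \<open>\<epsilon> * s\<close> and not at 0. So it
  has slope 1 and vanishes near \<open>p\<close>, but between \<open>p\<close> and a point at distance \<open>s\<close> it still has the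
  difference quotient \<open>1 - \<epsilon>\<close>.\<close>

definition tent :: "real \<Rightarrow> 'a::metric_space \<Rightarrow> real \<Rightarrow> 'a \<Rightarrow> real" where
  "tent \<epsilon> p s x = max 0 ((1 - \<epsilon>) * s - \<bar>dist x p - s\<bar>)"

text \<open>By the product rule the cutoff adds at most \<open>\<bar>f y - f p\<bar> * \<bar>\<chi> y - \<chi> x\<bar>\<close> to the increment of \<open>f\<close>. For \<open>y\<close>
  the point closer to \<open>p\<close> this is at most \<open>\<eta> * dist x y\<close>, which is the slack left by \<open>f\<close>.\<close>

lemma flatten_lipschitz:
  assumes "0 < \<eta>" "\<eta> \<le> 1" "s > 0" and f: "\<And>x y. \<bar>f x - f y\<bar> \<le> (1 - \<eta>) * dist x y"
  shows "\<bar>flatten \<eta> B p s f x - flatten \<eta> B p s f y\<bar> \<le> dist x y"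
proof -
  have *: "\<bar>flatten \<eta> B p s f x - flatten \<eta> B p s f y\<bar> \<le> dist x y"
    if le: "dist y p \<le> dist x p" for x y
  proof -
    let ?\<chi> = "radial_cutoff \<eta> B p s"
    have \<chi>: "0 \<le> ?\<chi> x" "?\<chi> x \<le> 1" by (auto simp: radial_cutoff_def log_cutoff_bounds)
    have "flatten \<eta> B p s f x - flatten \<eta> B p s f y
        = (1 - ?\<chi> x) * (f x - f y) + (f y - f p) * (?\<chi> y - ?\<chi> x)"
      by (simp add: flatten_def algebra_simps)
    also have "\<bar>\<dots>\<bar> \<le> \<bar>1 - ?\<chi> x\<bar> * \<bar>f x - f y\<bar> + \<bar>f y - f p\<bar> * \<bar>?\<chi> y - ?\<chi> x\<bar>"
      by (metis abs_mult abs_triangle_ineq)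
    also have "\<dots> \<le> 1 * ((1 - \<eta>) * dist x y) + dist y p * \<bar>?\<chi> y - ?\<chi> x\<bar>"
    proof (intro add_mono mult_mono f order_refl)
      have "(1 - \<eta>) * dist y p \<le> 1 * dist y p"
        using assms by (intro mult_right_mono) auto
      then show "\<bar>f y - f p\<bar> \<le> dist y p" using f[of y p] by linarith
    qed (use \<chi> in auto)
    also have "\<dots> \<le> (1 - \<eta>) * dist x y + \<eta> * dist x y"
      using radial_cutoff_slope[OF assms(1,3) le] by simp
    finally show ?thesis by (simp add: algebra_simps)
  qed
  show ?thesis
    using *[of y x] *[of x y] by (cases "dist y p \<le> dist x p") (auto simp: dist_commute abs_minus_commute)
qed

lemma tent_lipschitz: "\<bar>tent \<epsilon> p s x - tent \<epsilon> p s y\<bar> \<le> dist x y"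
  using dist_triangle[of x p y] dist_triangle[of y p x] by (auto simp: tent_def dist_commute)

text \<open>The only critical pairs have \<open>x\<close> under the tent and \<open>y\<close> off the plateau of the cutoff. If \<open>y\<close> is
  within \<open>\<epsilon> * s / 2\<close> of \<open>p\<close>, the part of the distance from \<open>p\<close> to \<open>x\<close> before the tent starts compensates
  for the values near \<open>y\<close>; this is where \<open>2 / \<epsilon> \<le> B\<close> enters. If \<open>y\<close> is farther than \<open>3 * s / \<eta>\<close>, then the
  slack \<open>\<eta> * dist y p\<close> of \<open>f\<close> pays for the height of the tent and for the detour through \<open>p\<close>.\<close>

lemma flatten_plus_tent_lipschitz:
  assumes \<eta>: "0 < \<eta>" "\<eta> \<le> 1" and \<epsilon>: "0 < \<epsilon>" "\<epsilon> \<le> 1" and s: "s > 0"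
    and B: "2 / \<epsilon> \<le> B" "3 / \<eta> \<le> B"
    and f: "\<And>x y. \<bar>f x - f y\<bar> \<le> (1 - \<eta>) * dist x y"
    and \<sigma>: "\<bar>\<sigma>\<bar> = 1"
  shows "\<bar>(flatten \<eta> B p s f x + \<sigma> * tent \<epsilon> p s x) - (flatten \<eta> B p s f y + \<sigma> * tent \<epsilon> p s y)\<bar> \<le> dist x y"
proof -
  let ?G = "flatten \<eta> B p s f" and ?\<phi> = "tent \<epsilon> p s" and ?\<chi> = "radial_cutoff \<eta> B p s"
  have B1: "B \<ge> 1" using B(2) \<eta> by (smt (verit) le_divide_eq_1_pos)
  have Bs: "2 * s \<le> B * (\<epsilon> * s)" "3 * s \<le> \<eta> * (B * s)"
    using B \<eta> \<epsilon> s by (simp_all add: divide_le_eq mult.commute)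
  have plateau: "?G x = 0" if "s / B \<le> dist x p" "dist x p \<le> s * B" for x
  proof -
    have "?\<chi> x = 1" unfolding radial_cutoff_def using \<eta>(1) B1
      by (rule log_cutoff_eq_1) (use that s B1 in \<open>auto simp: field_simps\<close>)
    then show ?thesis by (simp add: flatten_def)
  qed
  have Gp: "\<bar>?G x\<bar> \<le> (1 - \<eta>) * dist x p" for x
  proof -
    have "\<bar>?G x\<bar> = \<bar>1 - ?\<chi> x\<bar> * \<bar>f x - f p\<bar>" by (simp add: flatten_def abs_mult)
    also have "\<dots> \<le> 1 * ((1 - \<eta>) * dist x p)"
      by (intro mult_mono f) (auto simp: radial_cutoff_def log_cutoff_bounds)
    finally show ?thesis by simp
  qed
  have inner: "s / B \<le> \<epsilon> * s / 2" using Bs B1 by (simp add: field_simps)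
  have \<epsilon>s: "\<epsilon> * s > 0" using \<epsilon> s by simp
  have "2 / 1 \<le> 2 / \<epsilon>" using \<epsilon> by (intro divide_left_mono) auto
  then have "s * 2 \<le> s * B" using B(1) s by (intro mult_left_mono) auto
  have supp: "\<epsilon> * s < dist x p" "dist x p < 2 * s" "?\<phi> x \<le> dist x p - \<epsilon> * s" "?\<phi> x \<le> s" "?\<phi> x \<ge> 0"
    if "?\<phi> x \<noteq> 0" for x
    using that \<epsilon> s by (auto simp: tent_def max_def algebra_simps split: if_splits) (smt (verit) mult_pos_pos)+
  have *: "\<bar>(?G x + \<sigma> * ?\<phi> x) - (?G y + \<sigma> * ?\<phi> y)\<bar> \<le> dist x y" if x: "?\<phi> x \<noteq> 0" for x y
  proof -
    have Gx: "?G x = 0"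
      using supp(1,2)[OF x] inner \<open>s * 2 \<le> s * B\<close> \<epsilon>s by (intro plateau) linarith+
    consider "?G y = 0" | "dist y p < s / B" | "s * B < dist y p"
      using plateau[of y] by linarith
    then show ?thesis
    proof cases
      case 1
      have "\<bar>\<sigma> * ?\<phi> x - \<sigma> * ?\<phi> y\<bar> = \<bar>?\<phi> x - ?\<phi> y\<bar>"
        using \<sigma> by (simp add: abs_mult flip: right_diff_distrib)
      then show ?thesis using 1 Gx tent_lipschitz[of \<epsilon> p s x y] by simp
    next
      case 2
      then have y0: "?\<phi> y = 0" using supp(1)[of y] inner \<epsilon>s by linarith
      have "(1 - \<eta>) * dist y p \<le> 1 * dist y p" using \<eta> by (intro mult_right_mono) auto
      then have "\<bar>?G y\<bar> \<le> dist y p" using Gp[of y] by linarith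
      moreover have "\<bar>\<sigma> * ?\<phi> x\<bar> \<le> dist x p - \<epsilon> * s" using \<sigma> supp[OF x] by (simp add: abs_mult)
      ultimately show ?thesis
        using Gx y0 2 inner dist_triangle[of x p y] unfolding y0 Gx by argo
    next
      case 3
      then have y0: "?\<phi> y = 0" using supp[of y] \<open>s * 2 \<le> s * B\<close> by (smt (verit))
      have "\<eta> * (B * s) \<le> \<eta> * dist y p"
        using 3 \<eta> by (intro mult_left_mono) (simp_all add: mult.commute)
      then have "3 * s \<le> \<eta> * dist y p" using Bs(2) by linarith
      then have "\<bar>?G y\<bar> \<le> dist y p - 3 * s" using Gp[of y] by (simp add: algebra_simps)
      moreover have "\<bar>\<sigma> * ?\<phi> x\<bar> \<le> s" using \<sigma> supp[OF x] by (simp add: abs_mult)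
      ultimately show ?thesis
        using Gx y0 supp(2)[OF x] dist_triangle[of y p x] by (simp add: dist_commute)
    qed
  qed
  show ?thesis
  proof (cases "?\<phi> x = 0 \<and> ?\<phi> y = 0")
    case True
    then show ?thesis using flatten_lipschitz[OF \<eta> s f] by simp
  next
    case False
    then show ?thesis using *[of x y] *[of y x] by (auto simp: dist_commute abs_minus_commute)
  qed
qed


section \<open>Disjoint annuli\<close>

text \<open>A ratio of at least \<open>A\<^sup>2\<close> between consecutive radii puts the outer radius \<open>A * s i\<close> of an annulus below the
  inner radius \<open>s j / A\<close> of the next larger one.\<close>

lemma nested_annuli:
  fixes s :: "nat \<Rightarrow> real"
  assumes A: "A \<ge> 1" and pos: "\<And>n. s n > 0"
    and step: "(\<forall>n. A ^ 2 * s n \<le> s (Suc n)) \<or> (\<forall>n. A ^ 2 * s (Suc n) \<le> s n)"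
    and "n \<noteq> m" "s n / A < t" "t < A * s n" "s m / A < t" "t < A * s m"
  shows False
proof -
  have A2: "A ^ 2 \<ge> 1" using A by simp
  have le1: "x \<le> A ^ 2 * x" if "x > 0" for x
    using A2 that mult_right_mono[of 1 "A ^ 2" x] by simp
  have gap: "A ^ 2 * s i \<le> s j \<or> A ^ 2 * s j \<le> s i" if "i < j" for i j
    using that
  proof (induction j)
    case (Suc j)
    from step show ?case
    proof
      assume st: "\<forall>n. A ^ 2 * s n \<le> s (Suc n)"
      then have "s n \<le> s (Suc n)" for n using le1[OF pos[of n]] by (meson order_trans)
      then have "mono s" by (simp add: mono_iff_le_Suc)
      then have "A ^ 2 * s i \<le> A ^ 2 * s j" using Suc A2 by (intro mult_left_mono) (auto simp: mono_def)
      then show ?thesis using st[rule_format, of j] by linarith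
    next
      assume st: "\<forall>n. A ^ 2 * s (Suc n) \<le> s n"
      then have "s (Suc n) \<le> s n" for n using le1[OF pos[of "Suc n"]] by (meson order_trans)
      then have "antimono s" by (simp add: antimono_iff_le_Suc)
      then have "s j \<le> s i" using Suc by (auto simp: antimono_def)
      then show ?thesis using st[rule_format, of j] by linarith
    qed
  qed simp
  have "\<not> A ^ 2 * s i \<le> s j" if "t < A * s i" "s j / A < t" for i j
  proof
    assume "A ^ 2 * s i \<le> s j"
    then have "A * s i \<le> s j / A" using A by (simp add: field_simps power2_eq_square)
    then show False using that by linarith
  qed
  then show False using gap[of n m] gap[of m n] assms(4-) by (metis linorder_neqE_nat)
qed

text \<open>Without a convergent subsequence the range is not totally bounded, and points not covered by the
  balls around the earlier ones are chosen greedily. The freedom to start beyond any \<open>N\<close> is possible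
  because the first \<open>N\<close> points may be thrown in with the balls to be avoided. The indices need not
  increase; it matters only that they are at least \<open>N\<close>.\<close>

lemma infinite_separated_subsequence:
  fixes x :: "nat \<Rightarrow> 'a::complete_space"
  assumes "\<And>l r. strict_mono r \<Longrightarrow> \<not> (x \<circ> r) \<longlonglongrightarrow> l"
  obtains \<delta> where "\<delta> > 0"
    and "\<And>N. \<exists>r :: nat \<Rightarrow> nat. \<forall>n. N \<le> r n \<and> (\<forall>m<n. \<delta> \<le> dist (x (r n)) (x (r m)))"
proof -
  have "\<not> compact (closure (range x))"
  proof
    assume "compact (closure (range x))"
    moreover have "\<forall>n. x n \<in> closure (range x)" by (simp add: closure_subset[THEN subsetD])
    ultimately obtain l r where "strict_mono r" "(x \<circ> r) \<longlonglongrightarrow> l"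
      unfolding compact_eq_seq_compact_metric by (metis seq_compactE)
    then show False using assms by blast
  qed
  then obtain e where e: "e > 0" "\<And>K. finite K \<Longrightarrow> \<not> closure (range x) \<subseteq> (\<Union>y\<in>K. ball y e)"
    unfolding compact_eq_totally_bounded complete_eq_closed by auto
  have uncovered: "\<exists>n. \<forall>y\<in>K. e / 2 \<le> dist (x n) y" if K: "finite K" for K
  proof (rule ccontr)
    assume "\<not> ?thesis"
    then have "range x \<subseteq> (\<Union>y\<in>K. cball y (e / 2))"
      by (fastforce simp: not_le dist_commute intro: less_imp_le)
    moreover have "closed (\<Union>y\<in>K. cball y (e / 2))" using K by auto
    ultimately have "closure (range x) \<subseteq> (\<Union>y\<in>K. cball y (e / 2))" by (rule closure_minimal)
    also have "\<dots> \<subseteq> (\<Union>y\<in>K. ball y e)" using e(1) by (intro UN_mono) auto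
    finally show False using e(2)[OF K] by simp
  qed
  have "\<exists>r :: nat \<Rightarrow> nat. \<forall>n. N \<le> r n \<and> (\<forall>m<n. e / 2 \<le> dist (x (r n)) (x (r m)))" for N
  proof (rule dependent_wellorder_choice)
    fix n :: nat and r :: "nat \<Rightarrow> nat"
    obtain k where k: "\<forall>y\<in>x ` ({..<N} \<union> r ` {..<n}). e / 2 \<le> dist (x k) y"
      using uncovered[of "x ` ({..<N} \<union> r ` {..<n})"] by auto
    have "\<not> k < N" using k e(1) by (metis UnI1 dist_self half_gt_zero imageI lessThan_iff not_le)
    then show "\<exists>k. N \<le> k \<and> (\<forall>m<n. e / 2 \<le> dist (x k) (x (r m)))"
      using k by (intro exI[of _ k]) auto
  qed auto
  then show thesis using that[of "e / 2"] e(1) by auto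
qed

definition annulus :: "real \<Rightarrow> 'a::metric_space \<Rightarrow> real \<Rightarrow> 'a set" where
  "annulus A p s = {x. s / A < dist x p \<and> dist x p < A * s}"

text \<open>A bounded space that is not uniformly discrete has pairs \<open>x n \<noteq> y n\<close> with distances tending to 0. If some
  subsequence of \<open>x\<close> converges, then its limit is an accumulation point, and the annuli shrink to it.
  Otherwise a separated choice of the \<open>x n\<close> works with pairs so close together that the annuli stay
  in disjoint balls.\<close>

lemma disjoint_annuli:
  assumes M: "\<not> bounded (UNIV :: 'a::complete_space set) \<or> \<not> uniform_discrete (UNIV :: 'a set)"
    and A: "A \<ge> 1"
  obtains p z :: "nat \<Rightarrow> 'a::complete_space" where "\<And>n. p n \<noteq> z n"
    and "\<And>n m. n \<noteq> m \<Longrightarrow>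
      annulus A (p n) (dist (z n) (p n)) \<inter> annulus A (p m) (dist (z m) (p m)) = {}"
proof -
  note witness = that
  have concentric: thesis
    if z: "\<And>n. 0 < dist (z n) p"
      "(\<forall>n. A ^ 2 * dist (z n) p \<le> dist (z (Suc n)) p) \<or> (\<forall>n. A ^ 2 * dist (z (Suc n)) p \<le> dist (z n) p)"
    for p :: 'a and z
  proof (rule witness[of "\<lambda>_. p" z])
    show "p \<noteq> z n" for n using z(1)[of n] by auto
    show "annulus A p (dist (z n) p) \<inter> annulus A p (dist (z m) p) = {}" if "n \<noteq> m" for n m
      using nested_annuli[OF A z that] unfolding annulus_def by blast
  qed
  show thesis
  proof (cases "bounded (UNIV :: 'a set)")
    case False
    obtain p :: 'a where True by simp
    have far: "\<exists>x. r < dist x p" for r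
      using False unfolding bounded_def by (metis UNIV_I dist_commute not_le)
    have "\<exists>z. \<forall>n. 0 < dist (z n) p \<and> A ^ 2 * dist (z n) p \<le> dist (z (Suc n)) p"
    proof (rule dependent_nat_choice)
      show "\<exists>x. 0 < dist x p" by (rule far)
      fix x n assume "0 < dist x p"
      obtain y where "max (A ^ 2 * dist x p) 0 < dist y p" using far by blast
      then show "\<exists>y. 0 < dist y p \<and> A ^ 2 * dist x p \<le> dist y p"
        unfolding max_less_iff_conj by (meson less_imp_le)
    qed
    then show thesis using concentric by blast
  next
    case True
    then have "\<exists>x y :: 'a. x \<noteq> y \<and> dist x y < e" if "e > 0" for e
      using M that unfolding uniform_discrete_def by blast
    then have "\<exists>x y :: 'a. x \<noteq> y \<and> dist x y < 1 / real (Suc n)" for n by simp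
    then obtain x y :: "nat \<Rightarrow> 'a" where xy: "\<And>n. x n \<noteq> y n" "\<And>n. dist (x n) (y n) < 1 / real (Suc n)"
      by metis
    show thesis
    proof (cases "\<exists>l r. strict_mono r \<and> (x \<circ> r) \<longlonglongrightarrow> l")
      case True
      then obtain l r where r: "strict_mono r" "(x \<circ> r) \<longlonglongrightarrow> l" by blast
      have "(\<lambda>n. dist ((x \<circ> r) n) ((y \<circ> r) n)) \<longlonglongrightarrow> 0"
      proof (rule Lim_null_comparison)
        show "(\<lambda>n. 1 / real (Suc n)) \<longlonglongrightarrow> 0" by (rule lim_1_over_n[THEN LIMSEQ_Suc])
        have "1 / real (Suc (r n)) \<le> 1 / real (Suc n)" for n
          using seq_suble[OF r(1), of n] by (intro divide_left_mono) auto
        then show "\<forall>\<^sub>F n in sequentially. norm (dist ((x \<circ> r) n) ((y \<circ> r) n)) \<le> 1 / real (Suc n)"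
          using xy(2) by (intro always_eventually allI) (simp, meson less_imp_le order_trans)
      qed
      moreover have "(\<lambda>n. dist ((x \<circ> r) n) l) \<longlonglongrightarrow> 0" using r(2) tendsto_dist_iff by blast
      ultimately have lim: "(\<lambda>n. dist ((x \<circ> r) n) ((y \<circ> r) n) + dist ((x \<circ> r) n) l) \<longlonglongrightarrow> 0 + 0"
        by (rule tendsto_add)
      have near: "\<exists>z. 0 < dist z l \<and> dist z l < e" if e: "e > 0" for e
      proof -
        have "\<forall>\<^sub>F n in sequentially. dist ((x \<circ> r) n) ((y \<circ> r) n) + dist ((x \<circ> r) n) l < e"
          using order_tendstoD(2)[OF lim] e by simp
        then obtain n where n: "dist (x (r n)) (y (r n)) + dist (x (r n)) l < e"
          by (auto simp: eventually_sequentially)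
        then have "dist (x (r n)) l < e" "dist (y (r n)) l < e"
          using dist_triangle[of "y (r n)" l "x (r n)"]
          by (smt (verit) zero_le_dist, smt (verit) dist_commute)
        then show ?thesis using xy(1)[of "r n"] by (metis zero_less_dist_iff)
      qed
      have "\<exists>z. \<forall>n. 0 < dist (z n) l \<and> A ^ 2 * dist (z (Suc n)) l \<le> dist (z n) l"
      proof (rule dependent_nat_choice)
        show "\<exists>x. 0 < dist x l" using near[of 1] by auto
        fix x n assume "0 < dist x l"
        then obtain w where "0 < dist w l" "dist w l < dist x l / A ^ 2"
          using near[of "dist x l / A ^ 2"] A by auto
        then show "\<exists>w. 0 < dist w l \<and> A ^ 2 * dist w l \<le> dist x l"
          using A by (intro exI[of _ w]) (auto simp: field_simps)
      qed
      then show thesis using concentric by blast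
    next
      case False
      then obtain \<delta> where \<delta>: "\<delta> > 0"
        "\<And>N. \<exists>r :: nat \<Rightarrow> nat. \<forall>n. N \<le> r n \<and> (\<forall>m<n. \<delta> \<le> dist (x (r n)) (x (r m)))"
        using infinite_separated_subsequence[of x] by blast
      obtain N where N: "2 * A / \<delta> < real N" using reals_Archimedean2 by blast
      obtain r :: "nat \<Rightarrow> nat" where
        r: "\<forall>n. N \<le> r n \<and> (\<forall>m<n. \<delta> \<le> dist (x (r n)) (x (r m)))"
        using \<delta>(2)[of N] by (elim exE)
      have small: "A * dist (y (r n)) (x (r n)) < \<delta> / 2" for n
      proof -
        have "2 * A / \<delta> < real (Suc (r n))" using N r[rule_format, of n] by linarith
        then have "A * (1 / real (Suc (r n))) < \<delta> / 2"
          using \<delta>(1) by (simp add: field_simps)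
        moreover have "A * dist (y (r n)) (x (r n)) \<le> A * (1 / real (Suc (r n)))"
          using A xy(2)[of "r n"] by (intro mult_left_mono) (auto simp: dist_commute)
        ultimately show ?thesis by linarith
      qed
      show thesis
      proof (rule witness[of "x \<circ> r" "y \<circ> r"])
        fix n m :: nat assume "n \<noteq> m"
        then have "\<delta> \<le> dist (x (r n)) (x (r m))"
          using r by (metis dist_commute linorder_neqE_nat)
        then show "annulus A ((x \<circ> r) n) (dist ((y \<circ> r) n) ((x \<circ> r) n))
            \<inter> annulus A ((x \<circ> r) m) (dist ((y \<circ> r) m) ((x \<circ> r) m)) = {}"
          using small[of n] small[of m]
          by (auto simp: annulus_def) (smt (verit) dist_commute dist_triangle)
      qed (simp add: xy)
    qed
  qed
qed

section \<open>Disjointly supported Lipschitz functions are weakly null\<close>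

text \<open>Subtracting the value at the origin changes no Lipschitz estimate, so supports may contain the
  origin.\<close>

definition lip0_of :: "('a::pointed_metric_space \<Rightarrow> real) \<Rightarrow> 'a lip0" where
  "lip0_of f = Abs_lip0 (\<lambda>x. f x - f origin)"

lemma apply_lip0_of:
  assumes "\<And>x y. \<bar>f x - f y\<bar> \<le> C * dist x y" "C \<ge> 0"
  shows "apply_lip0 (lip0_of f) x = f x - f origin"
proof -
  have "C-lipschitz_on UNIV (\<lambda>x. f x - f origin)"
    using assms by (auto simp: lipschitz_on_def dist_real_def)
  then show ?thesis unfolding lip0_of_def by (subst Abs_lip0_inverse) auto
qed

lemma norm_lip0_le:
  assumes "\<And>x y. \<bar>apply_lip0 f x - apply_lip0 f y\<bar> \<le> C * dist x y" "C \<ge> 0"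
  shows "norm f \<le> C"
  using assms by transfer (rule lip_norm_least)

lemma apply_lip0_diff_le: "\<bar>apply_lip0 f x - apply_lip0 f y\<bar> \<le> norm f * dist x y"
  by transfer (rule lip_norm_upper, auto)

lemma norm_lip0_of_le:
  assumes "\<And>x y. \<bar>f x - f y\<bar> \<le> C * dist x y" "C \<ge> 0"
  shows "norm (lip0_of f) \<le> C"
  using assms by (intro norm_lip0_le) (simp_all add: apply_lip0_of[OF assms])

lemma apply_lip0_add: "apply_lip0 (f + g) x = apply_lip0 f x + apply_lip0 g x"
  by transfer simp

lemma apply_lip0_minus: "apply_lip0 (f - g) x = apply_lip0 f x - apply_lip0 g x"
  by transfer simp

lemma apply_lip0_scaleR: "apply_lip0 (r *\<^sub>R f) x = r * apply_lip0 f x"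
  by transfer simp

lemma apply_lip0_sum: "apply_lip0 (\<Sum>i\<in>I. f i) x = (\<Sum>i\<in>I. apply_lip0 (f i) x)"
  by (induction I rule: infinite_finite_induct) (simp_all add: apply_lip0_add zero_lip0.rep_eq)

text \<open>All but at most two of the functions vanish at both of two given points, so every finite signed
  sum has norm at most \<open>2 * C\<close>. With the signs of \<open>\<xi> (lip0_of (w n))\<close>, the functional adds up the absolute values,
  so it can exceed \<open>\<delta>\<close> only finitely often.\<close>

lemma disjoint_supports_weakly_null:
  fixes w :: "nat \<Rightarrow> 'a::pointed_metric_space \<Rightarrow> real" and \<xi> :: "'a lip0 \<Rightarrow>\<^sub>L real"
  assumes w: "\<And>n x y. \<bar>w n x - w n y\<bar> \<le> C * dist x y" and C: "C \<ge> 0"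
    and disj: "\<And>n m x. n \<noteq> m \<Longrightarrow> w n x = 0 \<or> w m x = 0"
    and "\<delta> > 0"
  shows "finite {n. \<delta> \<le> \<bar>\<xi> (lip0_of (w n))\<bar>}"
proof (rule ccontr)
  let ?S = "{n. \<delta> \<le> \<bar>\<xi> (lip0_of (w n))\<bar>}"
  assume "infinite ?S"
  obtain k :: nat where k: "norm \<xi> * (2 * C) / \<delta> < real k" using reals_Archimedean2 by blast
  obtain N where N: "finite N" "card N = k" "N \<subseteq> ?S"
    using infinite_arbitrarily_large[OF \<open>infinite ?S\<close>] by blast
  define \<sigma> where "\<sigma> n = sgn (\<xi> (lip0_of (w n)))" for n
  define h where "h = (\<Sum>n\<in>N. \<sigma> n *\<^sub>R lip0_of (w n))"
  have "norm h \<le> 2 * C"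
  proof (rule norm_lip0_le)
    fix x y
    let ?K = "{n\<in>N. w n x \<noteq> 0} \<union> {n\<in>N. w n y \<noteq> 0}"
    have one: "card {n\<in>N. w n v \<noteq> 0} \<le> 1" for v
      using disj N(1) by (subst card_le_Suc0_iff_eq[unfolded One_nat_def[symmetric]]) auto
    have "card ?K \<le> 2" using card_Un_le[of "{n\<in>N. w n x \<noteq> 0}" "{n\<in>N. w n y \<noteq> 0}"] one[of x] one[of y] by simp
    have "apply_lip0 h x - apply_lip0 h y = (\<Sum>n\<in>N. \<sigma> n * (w n x - w n y))"
      by (simp add: h_def apply_lip0_sum apply_lip0_scaleR apply_lip0_of[OF w C] algebra_simps
          flip: sum_subtractf)
    also have "\<bar>\<dots>\<bar> \<le> (\<Sum>n\<in>N. \<bar>w n x - w n y\<bar>)"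
      by (rule order_trans[OF sum_abs sum_mono]) (auto simp: \<sigma>_def abs_mult sgn_if)
    also have "\<dots> = (\<Sum>n\<in>?K. \<bar>w n x - w n y\<bar>)"
      using N(1) by (intro sum.mono_neutral_right) auto
    also have "\<dots> \<le> real (card ?K) * (C * dist x y)" by (rule sum_bounded_above[OF w])
    also have "\<dots> \<le> 2 * (C * dist x y)" using \<open>card ?K \<le> 2\<close> C by (intro mult_right_mono) auto
    finally show "\<bar>apply_lip0 h x - apply_lip0 h y\<bar> \<le> 2 * C * dist x y" by simp
  qed (use C in simp)
  have "real k * \<delta> \<le> (\<Sum>n\<in>N. \<bar>\<xi> (lip0_of (w n))\<bar>)"
    using N sum_bounded_below[of N \<delta> "\<lambda>n. \<bar>\<xi> (lip0_of (w n))\<bar>"] by auto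
  also have "\<dots> = \<xi> h" by (simp add: h_def \<sigma>_def blinfun.sum_right blinfun.scaleR_right abs_sgn mult.commute)
  also have "\<dots> \<le> norm \<xi> * norm h" using norm_blinfun[of \<xi> h] by simp
  also have "\<dots> \<le> norm \<xi> * (2 * C)" using \<open>norm h \<le> 2 * C\<close> by (intro mult_left_mono) auto
  finally show False using k \<open>\<delta> > 0\<close> by (simp add: field_simps)
qed

section \<open>The symmetric strong diameter two property\<close>

lemma norm_approached:
  fixes \<xi> :: "'x::real_normed_vector \<Rightarrow>\<^sub>L real"
  assumes "norm \<xi> = 1" "c < 1"
  obtains x where "norm x \<le> 1" "\<xi> x > c"
proof -
  have "\<exists>x. norm x \<le> 1 \<and> \<xi> x > c"
  proof (rule ccontr)
    assume "\<not> ?thesis"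
    then have le: "\<And>x. norm x \<le> 1 \<Longrightarrow> \<xi> x \<le> c" by (meson not_le)
    have "norm (\<xi> x) \<le> max c 0 * norm x" for x
    proof (cases "x = 0")
      case False
      define v where "v = x /\<^sub>R norm x"
      have v: "norm v = 1" "x = norm x *\<^sub>R v" using False by (simp_all add: v_def)
      have "\<bar>\<xi> v\<bar> \<le> max c 0"
        using le[of v] le[of "- v"] v(1) by (simp add: blinfun.minus_right)
      then have "norm x * \<bar>\<xi> v\<bar> \<le> norm x * max c 0" by (rule mult_left_mono) simp
      moreover have "norm (\<xi> x) = norm x * \<bar>\<xi> v\<bar>"
        by (subst v(2)) (simp add: blinfun.scaleR_right abs_mult)
      ultimately show ?thesis by (simp add: mult.commute)
    qed simp
    then have "norm \<xi> \<le> max c 0" by (intro norm_blinfun_bound) auto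
    then show False using assms by auto
  qed
  then show thesis using that by blast
qed

theorem SSD2P_lip0:
  assumes M: "\<not> bounded (UNIV :: 'a::{complete_space, pointed_metric_space} set)
    \<or> \<not> uniform_discrete (UNIV :: 'a set)"
  shows "SSD2P TYPE('a lip0)"
  unfolding SSD2P_def
proof (intro allI impI)
  fix k :: nat and S :: "nat \<Rightarrow> 'a lip0 set" and \<epsilon>0 :: real
  assume k: "1 \<le> k" and \<epsilon>0: "0 < \<epsilon>0" and S: "\<forall>i\<in>{1..k}. is_slice (S i)"
  let ?I = "{1..k}"
  obtain \<xi> \<alpha>' where \<xi>: "\<And>i. i \<in> ?I \<Longrightarrow> norm (\<xi> i) = 1" "\<And>i. i \<in> ?I \<Longrightarrow> \<alpha>' i > 0"
    "\<And>i. i \<in> ?I \<Longrightarrow> S i = slice (\<xi> i) (\<alpha>' i)"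
    using S unfolding is_slice_def by metis
  define \<alpha> where "\<alpha> = min 1 (Min (\<alpha>' ` ?I))"
  have \<alpha>: "0 < \<alpha>" "\<alpha> \<le> 1" "\<And>i. i \<in> ?I \<Longrightarrow> \<alpha> \<le> \<alpha>' i"
    using k \<xi>(2) by (auto simp: \<alpha>_def min_le_iff_disj)
  \<comment> \<open>The distance \<open>\<alpha>\<close> to the edge of the slices is spent in quarters: two to make room in the norm of
    \<open>f i\<close>, one for the change of \<open>f i\<close>, one for the bump.\<close>
  define \<eta> where "\<eta> = \<alpha> / 4"
  have \<eta>: "0 < \<eta>" "\<eta> \<le> 1" using \<alpha> by (auto simp: \<eta>_def)
  define \<epsilon> where "\<epsilon> = min 1 (\<epsilon>0 / 2)"
  have \<epsilon>: "0 < \<epsilon>" "\<epsilon> \<le> 1" "\<epsilon> < \<epsilon>0" using \<epsilon>0 by (auto simp: \<epsilon>_def)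
  have "\<exists>f. norm f \<le> 1 - \<eta> \<and> \<xi> i f > 1 - \<alpha> / 2" if i: "i \<in> ?I" for i
  proof -
    obtain g where g: "norm g \<le> 1" "\<xi> i g > 1 - \<eta>"
      using norm_approached[OF \<xi>(1)[OF i], of "1 - \<eta>"] \<eta> by auto
    show ?thesis
    proof (intro exI conjI)
      show "norm ((1 - \<eta>) *\<^sub>R g) \<le> 1 - \<eta>" using g(1) \<eta> by (simp add: mult_left_le)
      have "(1 - \<eta>) * (1 - \<eta>) \<le> (1 - \<eta>) * \<xi> i g" using g \<eta> by (intro mult_left_mono) auto
      moreover have "(1 - \<eta>) * (1 - \<eta>) = 1 - \<alpha> / 2 + \<eta> * \<eta>" by (simp add: \<eta>_def algebra_simps)
      moreover have "\<eta> * \<eta> > 0" using \<eta> by simp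
      ultimately show "\<xi> i ((1 - \<eta>) *\<^sub>R g) > 1 - \<alpha> / 2"
        unfolding blinfun.scaleR_right real_scaleR_def by linarith
    qed
  qed
  then obtain f where f: "\<And>i. i \<in> ?I \<Longrightarrow> norm (f i) \<le> 1 - \<eta>" "\<And>i. i \<in> ?I \<Longrightarrow> \<xi> i (f i) > 1 - \<alpha> / 2"
    by metis
  have f_lip: "\<bar>apply_lip0 (f i) x - apply_lip0 (f i) y\<bar> \<le> (1 - \<eta>) * dist x y" if "i \<in> ?I" for i x y
    using apply_lip0_diff_le[of "f i" x y] f(1)[OF that] mult_right_mono[of _ _ "dist x y"]
    by (meson order_trans zero_le_dist)
  define B where "B = max (2 / \<epsilon>) (3 / \<eta>)"
  have B: "2 / \<epsilon> \<le> B" "3 / \<eta> \<le> B" by (auto simp: B_def)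
  have "2 / 1 \<le> 2 / \<epsilon>" using \<epsilon> by (intro divide_left_mono) auto
  then have B2: "B \<ge> 2" using B by linarith
  define A where "A = B * exp (1 / \<eta>)"
  have AB: "A \<ge> B" using B2 \<eta> by (simp add: A_def mult_ge1_I)
  obtain p z :: "nat \<Rightarrow> 'a" where pz: "\<And>n. p n \<noteq> z n"
    and disj: "\<And>n m. n \<noteq> m \<Longrightarrow>
      annulus A (p n) (dist (z n) (p n)) \<inter> annulus A (p m) (dist (z m) (p m)) = {}"
    using disjoint_annuli[OF M, of A] AB B2 by auto
  define s where "s n = dist (z n) (p n)" for n
  have s: "s n > 0" for n using pz[of n] by (auto simp: s_def)
  define \<phi> where "\<phi> n = tent \<epsilon> (p n) (s n)" for n
  define g where "g i n = flatten \<eta> B (p n) (s n) (apply_lip0 (f i))" for i n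
  define u where "u i n x = apply_lip0 (f i) x - apply_lip0 (f i) (p n) - g i n x" for i n x
  have \<phi>_lip: "\<bar>\<phi> n x - \<phi> n y\<bar> \<le> 1 * dist x y" for n x y
    using tent_lipschitz by (simp add: \<phi>_def)
  have g_lip: "\<bar>g i n x - g i n y\<bar> \<le> 1 * dist x y" if "i \<in> ?I" for i n x y
    using flatten_lipschitz[OF \<eta> s f_lip[OF that]] by (simp add: g_def)
  have u_lip: "\<bar>u i n x - u i n y\<bar> \<le> 2 * dist x y" if "i \<in> ?I" for i n x y
  proof -
    have "(1 - \<eta>) * dist x y \<le> 1 * dist x y" using \<eta> by (intro mult_right_mono) auto
    then show ?thesis using f_lip[OF that, of x y] g_lip[OF that, of n x y] by (simp add: u_def)
  qed
  have \<phi>_supp: "x \<in> annulus A (p n) (s n)" if "\<phi> n x \<noteq> 0" for n x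
  proof -
    have "\<epsilon> * s n < dist x (p n)" "dist x (p n) < 2 * s n"
      using that \<epsilon> s[of n] by (auto simp: \<phi>_def tent_def max_def algebra_simps split: if_splits)
        (smt (verit) mult_pos_pos)+
    moreover have "s n / A \<le> \<epsilon> * s n"
    proof -
      have "1 \<le> A * \<epsilon>"
        using B(1) AB \<epsilon> mult_right_mono[of "2 / \<epsilon>" A \<epsilon>] by simp
      then have "s n * 1 \<le> s n * (A * \<epsilon>)" using s[of n] by (intro mult_left_mono) auto
      then show ?thesis using AB B2 by (simp add: field_simps)
    qed
    moreover have "2 * s n \<le> A * s n" using AB B2 s[of n] by (intro mult_right_mono) auto
    ultimately show ?thesis by (simp add: annulus_def)
  qed
  have u_supp: "x \<in> annulus A (p n) (s n)" if "u i n x \<noteq> 0" for i n x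
  proof -
    have "radial_cutoff \<eta> B (p n) (s n) x \<noteq> 0"
      using that by (auto simp: u_def g_def flatten_def algebra_simps)
    then have "\<not> (dist x (p n) / s n \<le> 1 / A \<or> A \<le> dist x (p n) / s n)"
      using log_cutoff_eq_0[of \<eta> B "dist x (p n) / s n"] \<eta> B2 unfolding radial_cutoff_def A_def by force
    then show ?thesis using s[of n] AB B2 by (auto simp: annulus_def field_simps)
  qed
  have apart: "x \<notin> annulus A (p n) (s n) \<or> x \<notin> annulus A (p m) (s m)" if "n \<noteq> m" for n m x
    using disj[OF that] unfolding s_def by blast
  have "finite {n. \<eta> \<le> \<bar>\<xi> i (lip0_of (\<phi> n))\<bar>}" for i
    using apart \<phi>_supp by (intro disjoint_supports_weakly_null[OF \<phi>_lip _ _ \<eta>(1)]) (simp, metis)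
  moreover have "finite {n. \<eta> \<le> \<bar>\<xi> i (lip0_of (u i n))\<bar>}" if "i \<in> ?I" for i
    using apart u_supp by (intro disjoint_supports_weakly_null[OF u_lip[OF that] _ _ \<eta>(1)]) (simp, metis)
  ultimately have "finite ((\<Union>i\<in>?I. {n. \<eta> \<le> \<bar>\<xi> i (lip0_of (\<phi> n))\<bar>}) \<union> (\<Union>i\<in>?I. {n. \<eta> \<le> \<bar>\<xi> i (lip0_of (u i n))\<bar>}))"
    by auto
  then obtain n where n: "n \<notin> (\<Union>i\<in>?I. {n. \<eta> \<le> \<bar>\<xi> i (lip0_of (\<phi> n))\<bar>}) \<union> (\<Union>i\<in>?I. {n. \<eta> \<le> \<bar>\<xi> i (lip0_of (u i n))\<bar>})"
    using ex_new_if_finite[OF infinite_UNIV_nat] by blast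
  let ?\<phi> = "lip0_of (\<phi> n)" and ?x = "\<lambda>i. lip0_of (g i n)"
  note app = apply_lip0_of[OF \<phi>_lip zero_le_one]
  have inS: "?x i + \<tau> *\<^sub>R ?\<phi> \<in> S i" if i: "i \<in> ?I" and \<tau>: "\<tau> = 0 \<or> \<tau> = 1 \<or> \<tau> = - 1" for i and \<tau> :: real
  proof -
    have "norm (?x i + \<tau> *\<^sub>R ?\<phi>) \<le> 1"
    proof (rule norm_lip0_le)
      fix x y
      have "apply_lip0 (?x i + \<tau> *\<^sub>R ?\<phi>) x - apply_lip0 (?x i + \<tau> *\<^sub>R ?\<phi>) y
          = (g i n x + \<tau> * \<phi> n x) - (g i n y + \<tau> * \<phi> n y)"
        by (simp add: apply_lip0_add apply_lip0_scaleR app apply_lip0_of[OF g_lip[OF i] zero_le_one] algebra_simps)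
      moreover have "\<bar>(g i n x + \<tau> * \<phi> n x) - (g i n y + \<tau> * \<phi> n y)\<bar> \<le> dist x y"
      proof (cases "\<tau> = 0")
        case False
        then have "\<bar>\<tau>\<bar> = 1" using \<tau> by auto
        from flatten_plus_tent_lipschitz[OF \<eta> \<epsilon>(1,2) s B f_lip[OF i] this]
        show ?thesis unfolding g_def \<phi>_def .
      qed (use g_lip[OF i] in simp)
      ultimately show "\<bar>apply_lip0 (?x i + \<tau> *\<^sub>R ?\<phi>) x - apply_lip0 (?x i + \<tau> *\<^sub>R ?\<phi>) y\<bar> \<le> 1 * dist x y"
        by simp
    qed simp
    moreover have "\<xi> i (?x i + \<tau> *\<^sub>R ?\<phi>) > 1 - \<alpha>"
    proof -
      have "?x i = f i - lip0_of (u i n)"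
      proof (rule apply_lip0_inject[THEN iffD1], rule ext)
        fix x
        have "apply_lip0 (f i) origin = 0" using apply_lip0 by fastforce
        then show "apply_lip0 (?x i) x = apply_lip0 (f i - lip0_of (u i n)) x"
          by (simp add: apply_lip0_minus apply_lip0_of[OF g_lip[OF i] zero_le_one]
              apply_lip0_of[OF u_lip[OF i] zero_le_numeral] u_def)
      qed
      then have "\<xi> i (?x i + \<tau> *\<^sub>R ?\<phi>) = \<xi> i (f i) - \<xi> i (lip0_of (u i n)) + \<tau> * \<xi> i ?\<phi>"
        by (simp add: blinfun.add_right blinfun.diff_right blinfun.scaleR_right)
      moreover have "\<bar>\<xi> i (lip0_of (u i n))\<bar> < \<eta>" "\<bar>\<xi> i ?\<phi>\<bar> < \<eta>" using n i by (auto simp: not_le)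
      ultimately show ?thesis using f(2)[OF i] \<tau> by (auto simp: \<eta>_def)
    qed
    ultimately show ?thesis using \<xi>(3)[OF i] \<alpha>(3)[OF i] by (auto simp: slice_def dist_norm)
  qed
  show "\<exists>x. \<exists>\<phi>\<in>cball 0 1. 1 - \<epsilon>0 < norm \<phi> \<and> (\<forall>i\<in>?I. x i \<in> S i \<and> x i + \<phi> \<in> S i \<and> x i - \<phi> \<in> S i)"
  proof (intro exI[of _ ?x] bexI[of _ ?\<phi>] conjI ballI)
    show "?\<phi> \<in> cball 0 1" using norm_lip0_of_le[OF \<phi>_lip] by (simp add: dist_norm)
    have "\<phi> n (z n) = (1 - \<epsilon>) * s n" "\<phi> n (p n) = 0"
      using s[of n] \<epsilon> by (simp_all add: \<phi>_def tent_def flip: s_def)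
    then have "(1 - \<epsilon>) * s n = \<bar>apply_lip0 ?\<phi> (z n) - apply_lip0 ?\<phi> (p n)\<bar>"
      using s[of n] \<epsilon> by (simp add: app)
    also have "\<dots> \<le> norm ?\<phi> * s n" unfolding s_def by (rule apply_lip0_diff_le)
    finally have "1 - \<epsilon> \<le> norm ?\<phi>" using s[of n] by simp
    then show "1 - \<epsilon>0 < norm ?\<phi>" using \<epsilon> by simp
  next
    fix i assume i: "i \<in> ?I"
    show "?x i \<in> S i" "?x i + ?\<phi> \<in> S i" "?x i - ?\<phi> \<in> S i"
      using inS[OF i, of 0] inS[OF i, of 1] inS[OF i, of "-1"] by simp_all
  qed
qed

section \<open>Octahedrality of the dual\<close>

lemma closed_span_if_compact_balls:
  fixes B :: "'x::real_normed_vector set"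
  assumes "\<And>R. compact (cball 0 R \<inter> span B)"
  shows "closed (span B)"
  unfolding closed_sequential_limits
proof (intro allI impI, elim conjE)
  fix f :: "nat \<Rightarrow> 'x" and l assume f: "\<forall>n. f n \<in> span B" "f \<longlonglongrightarrow> l"
  obtain R where "\<And>n. norm (f n) \<le> R"
    using convergent_imp_bounded[OF f(2)] by (auto simp: bounded_iff)
  then have "\<forall>n. f n \<in> cball 0 R \<inter> span B" using f by (simp add: dist_norm)
  then have "l \<in> cball 0 R \<inter> span B"
    using compact_imp_closed[OF assms] f(2) unfolding closed_sequential_limits by blast
  then show "l \<in> span B" by simp
qed

text \<open>By induction on the spanning set. When \<open>b\<close> is added to a span that is closed by the induction hypothesis,
  its distance \<open>D > 0\<close> to that span bounds the coefficient of \<open>b\<close> by \<open>norm y / D\<close>, and so the ball lies in the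
  sum of a compact segment and a compact ball of the smaller span.\<close>

lemma compact_cball_Int_span:
  fixes B :: "'x::real_normed_vector set"
  assumes "finite B"
  shows "compact (cball 0 R \<inter> span B)"
  using assms
proof (induction B arbitrary: R)
  case empty
  then show ?case by (simp add: finite_imp_compact)
next
  case (insert b B)
  show ?case
  proof (cases "b \<in> span B")
    case True
    then show ?thesis using insert by (simp add: span_redundant)
  next
    case False
    define D where "D = infdist b (span B)"
    have ne: "span B \<noteq> {}" using span_zero by blast
    have D: "D > 0"
      unfolding D_def using closed_span_if_compact_balls[OF insert.IH] False ne
      by (intro infdist_pos_not_in_closed)
    define K where "K = {x + v |x v. x \<in> (\<lambda>c. c *\<^sub>R b) ` {- (R / D)..R / D}
      \<and> v \<in> cball 0 (R + R / D * norm b) \<inter> span B}"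
    have "compact K" unfolding K_def
      by (intro compact_sums compact_continuous_image insert.IH) (auto intro!: continuous_intros)
    have "span B \<subseteq> span (insert b B)" by (rule span_mono) auto
    then have "K \<subseteq> span (insert b B)"
      unfolding K_def by (auto intro!: span_add span_scale[OF span_base])
    moreover have "cball 0 R \<inter> span (insert b B) \<subseteq> K"
    proof
      fix y assume "y \<in> cball 0 R \<inter> span (insert b B)"
      then obtain c where y: "norm y \<le> R" and v: "y - c *\<^sub>R b \<in> span B"
        by (auto simp: dist_norm span_breakdown_eq)
      have "\<bar>c\<bar> * D \<le> norm y"
      proof (cases "c = 0")
        case False
        have "- (1 / c) *\<^sub>R (y - c *\<^sub>R b) \<in> span B" using v by (rule span_scale)
        then have "D \<le> dist b (- (1 / c) *\<^sub>R (y - c *\<^sub>R b))" unfolding D_def by (rule infdist_le)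
        also have "\<dots> = norm ((1 / c) *\<^sub>R y)" using False by (simp add: dist_norm algebra_simps)
        finally show ?thesis using False by (simp add: field_simps)
      qed simp
      then have c: "\<bar>c\<bar> \<le> R / D" using y D by (simp add: field_simps)
      have "norm (y - c *\<^sub>R b) \<le> norm y + \<bar>c\<bar> * norm b"
        using norm_triangle_ineq4[of y "c *\<^sub>R b"] by simp
      also have "\<dots> \<le> R + R / D * norm b" using y c by (intro add_mono mult_right_mono) auto
      finally have "y - c *\<^sub>R b \<in> cball 0 (R + R / D * norm b) \<inter> span B"
        using v by (simp only: Int_iff mem_cball_0)
      moreover have "c *\<^sub>R b \<in> (\<lambda>c. c *\<^sub>R b) ` {- (R / D)..R / D}" using c by (intro imageI) auto
      moreover have "y = c *\<^sub>R b + (y - c *\<^sub>R b)" by simp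
      ultimately show "y \<in> K" unfolding K_def by blast
    qed
    ultimately have "cball 0 R \<inter> span (insert b B) = cball 0 R \<inter> K" by blast
    then show ?thesis using \<open>compact K\<close> by (simp add: closed_Int_compact)
  qed
qed

lemma finite_net_of_sphere:
  fixes B :: "'x::real_normed_vector set"
  assumes "finite B" "e > 0"
  obtains N where "finite N" "N \<subseteq> span B \<inter> sphere 0 1"
    "\<And>y. y \<in> span B \<inter> sphere 0 1 \<Longrightarrow> \<exists>v\<in>N. norm (y - v) < e"
proof -
  have "compact ((cball 0 1 \<inter> span B) - ball 0 1)"
    by (rule compact_diff[OF compact_cball_Int_span[OF assms(1)] open_ball])
  moreover have "(cball 0 1 \<inter> span B) - ball 0 1 = span B \<inter> sphere 0 1" by auto
  ultimately have "compact (span B \<inter> sphere 0 1)" by simp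
  moreover have "span B \<inter> sphere 0 1 \<subseteq> (\<Union>v\<in>span B \<inter> sphere 0 1. ball v e)"
    using assms(2) by auto
  ultimately obtain N where N: "N \<subseteq> span B \<inter> sphere 0 1" "finite N"
    "span B \<inter> sphere 0 1 \<subseteq> (\<Union>v\<in>N. ball v e)"
    by (rule compactE_image[OF _ open_ball])
  show thesis
  proof (rule that[OF N(2,1)])
    fix y assume "y \<in> span B \<inter> sphere 0 1"
    then obtain v where "v \<in> N" "y \<in> ball v e" using N(3) by blast
    then show "\<exists>v\<in>N. norm (y - v) < e" by (auto simp: dist_norm norm_minus_commute)
  qed
qed

text \<open>Let \<open>\<zeta>\<close> be a functional of norm 1 with \<open>\<zeta> \<phi>\<close> almost 1. Since \<open>x i + \<phi>\<close> and \<open>x i - \<phi>\<close> lie in the unit ball,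
  \<open>\<zeta> (x i)\<close> is almost 0, so \<open>\<zeta>\<close> is almost 1 at \<open>x i + \<phi>\<close> and almost \<open>-1\<close> at \<open>x i - \<phi>\<close>, while the functional that
  defines the \<open>i\<close>-th slice is almost 1 at both. Evaluation at the one that suits the sign of \<open>t\<close> gives
  the lower bound for the norm. The hypothesis \<open>norming\<close> is a consequence of the Hahn--Banach theorem in
  general; in a dual space it is elementary.\<close>

lemma SSD2P_imp_dual_octahedral:
  fixes w0 :: "'x::real_normed_vector"
  assumes X: "SSD2P TYPE('x)" and w0: "w0 \<noteq> 0"
    and norming: "\<And>(w :: 'x) c. c < norm w \<Longrightarrow> \<exists>\<xi> :: 'x \<Rightarrow>\<^sub>L real. norm \<xi> \<le> 1 \<and> c < blinfun_apply \<xi> w"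
  shows "octahedral TYPE('x \<Rightarrow>\<^sub>L real)"
  unfolding octahedral_def
proof (intro allI impI, elim conjE exE)
  fix Y B :: "('x \<Rightarrow>\<^sub>L real) set" and \<epsilon> :: real
  assume \<epsilon>: "\<epsilon> > 0" and B: "finite B" "Y = span B"
  define \<delta> where "\<delta> = min \<epsilon> 1 / 4"
  have \<delta>: "0 < \<delta>" "\<delta> \<le> 1 / 4" "3 * \<delta> \<le> \<epsilon>" using \<epsilon> by (auto simp: \<delta>_def)
  \<comment> \<open>A nonzero functional is added to \<open>B\<close>, since for \<open>Y = {0}\<close> the net would be empty and there would be no slice.\<close>
  obtain b :: "'x \<Rightarrow>\<^sub>L real" where "0 < b w0" using norming[of 0 w0] w0 by auto
  then have b: "b \<noteq> 0" by auto
  obtain N where N: "finite N" "N \<subseteq> span (insert b B) \<inter> sphere 0 1"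
    "\<And>y. y \<in> span (insert b B) \<inter> sphere 0 1 \<Longrightarrow> \<exists>v\<in>N. norm (y - v) < \<delta>"
    using finite_net_of_sphere[of "insert b B" \<delta>] B(1) \<delta>(1) by auto
  have "b /\<^sub>R norm b \<in> span (insert b B) \<inter> sphere 0 1"
    using b by (auto intro: span_scale span_base)
  then have "N \<noteq> {}" using N(3) by blast
  then have card: "1 \<le> card N" using N(1) by (simp add: Suc_le_eq card_gt_0_iff)
  obtain h where h: "bij_betw h {1..card N} N" using ex_bij_betw_nat_finite_1[OF N(1)] by blast
  have "norm (h i) = 1" if "i \<in> {1..card N}" for i
    using bij_betwE[OF h] that N(2) by (meson Int_iff mem_sphere_0 subsetD)
  then have "\<forall>i\<in>{1..card N}. is_slice (slice (h i) \<delta>)" using \<delta>(1) unfolding is_slice_def by blast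
  then obtain x \<phi> where \<phi>: "1 - \<delta> < norm \<phi>"
    and x: "\<And>i. i \<in> {1..card N} \<Longrightarrow> x i + \<phi> \<in> slice (h i) \<delta>" "\<And>i. i \<in> {1..card N} \<Longrightarrow> x i - \<phi> \<in> slice (h i) \<delta>"
    using X[unfolded SSD2P_def, rule_format, of "card N" \<delta> "\<lambda>i. slice (h i) \<delta>"] card \<delta>(1) by blast
  obtain \<xi> :: "'x \<Rightarrow>\<^sub>L real" where \<xi>: "norm \<xi> \<le> 1" "1 - \<delta> < \<xi> \<phi>" using norming[OF \<phi>] by blast
  define \<zeta> where "\<zeta> = \<xi> /\<^sub>R norm \<xi>"
  have "\<xi> \<noteq> 0" using \<xi>(2) \<delta> by auto
  then have \<zeta>: "norm \<zeta> = 1" by (simp add: \<zeta>_def)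
  have "\<xi> \<phi> * norm \<xi> \<le> \<xi> \<phi>" using \<xi> \<delta> by (simp add: mult_left_le)
  then have "\<xi> \<phi> \<le> \<zeta> \<phi>"
    using \<open>\<xi> \<noteq> 0\<close> by (simp add: \<zeta>_def blinfun.scaleR_left field_simps)
  then have \<zeta>\<phi>: "1 - \<delta> < \<zeta> \<phi>" using \<xi>(2) by linarith
  have net: "(1 - 2 * \<delta>) * (1 + \<bar>t\<bar>) \<le> norm (v + t *\<^sub>R \<zeta>)" if "v \<in> N" for v t
  proof -
    have "v \<in> h ` {1..card N}" using that by (simp only: bij_betw_imp_surj_on[OF h])
    then obtain i where i: "i \<in> {1..card N}" "h i = v" by (elim imageE) simp
    have slices: "norm (x i + \<phi>) \<le> 1" "norm (x i - \<phi>) \<le> 1" "1 - \<delta> < v (x i + \<phi>)" "1 - \<delta> < v (x i - \<phi>)"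
      using x[OF i(1)] unfolding i(2) slice_def mem_Collect_eq mem_cball_0 by simp_all
    have unit: "\<bar>\<zeta> y\<bar> \<le> 1" if "norm y \<le> 1" for y using norm_blinfun[of \<zeta> y] \<zeta> that by simp
    have \<zeta>x: "1 - 2 * \<delta> \<le> \<zeta> (x i + \<phi>)" "\<zeta> (x i - \<phi>) \<le> - (1 - 2 * \<delta>)"
      using unit[OF slices(1)] unit[OF slices(2)] \<zeta>\<phi>
      by (simp_all add: blinfun.add_right blinfun.diff_right)
    define y where "y = (if t \<ge> 0 then x i + \<phi> else x i - \<phi>)"
    have y: "norm y \<le> 1" "1 - \<delta> < v y" using slices by (simp_all add: y_def)
    have "\<bar>t\<bar> * (1 - 2 * \<delta>) \<le> t * \<zeta> y"
    proof (cases "t \<ge> 0")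
      case True
      then show ?thesis using \<zeta>x(1) by (simp add: y_def mult_left_mono)
    next
      case False
      then have "t * - (1 - 2 * \<delta>) \<le> t * \<zeta> y"
        unfolding y_def if_not_P[OF False] by (intro mult_left_mono_neg \<zeta>x(2)) simp
      moreover have "\<bar>t\<bar> * (1 - 2 * \<delta>) = t * - (1 - 2 * \<delta>)"
        unfolding abs_of_neg[OF False[unfolded not_le]] by (rule minus_mult_commute)
      ultimately show ?thesis by linarith
    qed
    then have "(1 - 2 * \<delta>) * (1 + \<bar>t\<bar>) \<le> v y + t * \<zeta> y" using y(2) \<delta>(1) by (simp add: algebra_simps)
    also have "\<dots> = (v + t *\<^sub>R \<zeta>) y" by (simp add: blinfun.add_left blinfun.scaleR_left)
    also have "\<dots> \<le> norm (v + t *\<^sub>R \<zeta>) * norm y" using norm_blinfun[of "v + t *\<^sub>R \<zeta>" y] by simp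
    also have "\<dots> \<le> norm (v + t *\<^sub>R \<zeta>)" using y(1) by (simp add: mult_left_le)
    finally show ?thesis .
  qed
  show "\<exists>x\<in>sphere 0 1. \<forall>y\<in>Y. \<forall>t. (1 - \<epsilon>) * (norm y + \<bar>t\<bar>) \<le> norm (y + t *\<^sub>R x)"
  proof (intro bexI[of _ \<zeta>] ballI allI)
    fix y t assume y: "y \<in> Y"
    show "(1 - \<epsilon>) * (norm y + \<bar>t\<bar>) \<le> norm (y + t *\<^sub>R \<zeta>)"
    proof (cases "y = 0")
      case True
      then show ?thesis using \<zeta> \<epsilon> by (simp add: mult_left_le_one_le algebra_simps)
    next
      case False
      define r where "r = norm y"
      have r: "r > 0" using False by (simp add: r_def)
      have "y /\<^sub>R r \<in> span (insert b B) \<inter> sphere 0 1"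
        using y B(2) span_mono[of B "insert b B"] False by (auto simp: r_def intro!: span_scale)
      then obtain v where v: "v \<in> N" "norm (y /\<^sub>R r - v) < \<delta>" using N(3) by blast
      let ?t = "t / r"
      have "(1 - \<epsilon>) * (1 + \<bar>?t\<bar>) \<le> (1 - 3 * \<delta>) * (1 + \<bar>?t\<bar>)" using \<delta> by (intro mult_right_mono) auto
      also have "\<dots> \<le> (1 - 2 * \<delta>) * (1 + \<bar>?t\<bar>) - \<delta>" using \<delta> by (simp add: algebra_simps)
      also have "\<dots> \<le> norm (v + ?t *\<^sub>R \<zeta>) - norm (y /\<^sub>R r - v)" using net[OF v(1), of ?t] v(2) by linarith
      also have "\<dots> \<le> norm (y /\<^sub>R r + ?t *\<^sub>R \<zeta>)"
        using norm_triangle_ineq4[of "y /\<^sub>R r + ?t *\<^sub>R \<zeta>" "y /\<^sub>R r - v"] by (simp add: algebra_simps)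
      finally have "r * ((1 - \<epsilon>) * (1 + \<bar>?t\<bar>)) \<le> r * norm (y /\<^sub>R r + ?t *\<^sub>R \<zeta>)"
        using r by (intro mult_left_mono) auto
      also have "\<dots> = norm (r *\<^sub>R (y /\<^sub>R r + ?t *\<^sub>R \<zeta>))" using r by simp
      also have "r *\<^sub>R (y /\<^sub>R r + ?t *\<^sub>R \<zeta>) = y + t *\<^sub>R \<zeta>" using r by (simp add: scaleR_add_right)
      also have "r * ((1 - \<epsilon>) * (1 + \<bar>?t\<bar>)) = (1 - \<epsilon>) * (norm y + \<bar>t\<bar>)"
        using r by (simp add: field_simps flip: r_def)
      finally show ?thesis .
    qed
  qed (use \<zeta> in simp)
qed

lemma evaluations_norm_dual:
  fixes w :: "'x::real_normed_vector \<Rightarrow>\<^sub>L real"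
  assumes "c < norm w"
  shows "\<exists>\<xi> :: ('x \<Rightarrow>\<^sub>L real) \<Rightarrow>\<^sub>L real. norm \<xi> \<le> 1 \<and> c < blinfun_apply \<xi> w"
proof (cases "w = 0")
  case True
  then show ?thesis using assms by (intro exI[of _ 0]) simp
next
  case False
  have "norm (w /\<^sub>R norm w) = 1" "c / norm w < 1" using False assms by simp_all
  then obtain x where x: "norm x \<le> 1" "c / norm w < (w /\<^sub>R norm w) x" by (rule norm_approached)
  define \<xi> where "\<xi> = Blinfun (\<lambda>v :: 'x \<Rightarrow>\<^sub>L real. v x)"
  have \<xi>: "\<xi> v = v x" for v
    by (simp add: \<xi>_def bounded_linear_Blinfun_apply blinfun.bounded_linear_left)
  have "norm \<xi> \<le> 1"
  proof (rule norm_blinfun_bound)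
    fix v :: "'x \<Rightarrow>\<^sub>L real"
    show "norm (\<xi> v) \<le> 1 * norm v"
      using norm_blinfun[of v x] mult_left_le[OF x(1) norm_ge_zero[of v]] by (simp add: \<xi>)
  qed simp
  moreover have "c < \<xi> w" using x(2) False by (simp add: \<xi> blinfun.scaleR_left field_simps)
  ultimately show ?thesis by blast
qed

lemma SSD2P_isometry:
  fixes T :: "'x::real_normed_vector \<Rightarrow> 'y::real_normed_vector"
  assumes X: "SSD2P TYPE('x)" and T: "linear T" "\<And>x. norm (T x) = norm x" "surj T"
  shows "SSD2P TYPE('y)"
  unfolding SSD2P_def
proof (intro allI impI)
  fix k :: nat and S :: "nat \<Rightarrow> 'y set" and \<epsilon> :: real
  assume k: "1 \<le> k" and \<epsilon>: "0 < \<epsilon>" and S: "\<forall>i\<in>{1..k}. is_slice (S i)"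
  have bl: "bounded_linear T"
    using T by (intro bounded_linear_intro[where K = 1]) (simp_all add: linear_add linear_scale)
  have "is_slice (T -` S i)" if i: "i \<in> {1..k}" for i
  proof -
    obtain \<xi> \<alpha> where \<xi>: "norm \<xi> = 1" "\<alpha> > 0" "S i = slice \<xi> \<alpha>"
      using S i unfolding is_slice_def by blast
    define \<theta> where "\<theta> = \<xi> o\<^sub>L Blinfun T"
    have \<theta>: "\<theta> x = \<xi> (T x)" for x by (simp add: \<theta>_def bounded_linear_Blinfun_apply[OF bl])
    have "norm \<theta> \<le> norm \<xi>"
      using norm_blinfun[of \<xi> "T _"] by (intro norm_blinfun_bound) (simp_all add: \<theta> T(2))
    moreover have "norm \<xi> \<le> norm \<theta>"
    proof (rule norm_blinfun_bound)
      fix y obtain x where "y = T x" using T(3) by blast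
      then show "norm (\<xi> y) \<le> norm \<theta> * norm y" using norm_blinfun[of \<theta> x] by (simp add: \<theta> T(2))
    qed simp
    moreover have "T -` S i = slice \<theta> \<alpha>" using \<xi>(3) by (auto simp: slice_def \<theta> dist_norm T(2))
    ultimately show ?thesis using \<xi> unfolding is_slice_def by (intro exI[of _ \<theta>] exI[of _ \<alpha>]) simp
  qed
  then obtain x \<phi> where "norm \<phi> \<le> 1" "1 - \<epsilon> < norm \<phi>"
    "\<forall>i\<in>{1..k}. x i \<in> T -` S i \<and> x i + \<phi> \<in> T -` S i \<and> x i - \<phi> \<in> T -` S i"
    using X[unfolded SSD2P_def, rule_format, of k \<epsilon> "\<lambda>i. T -` S i"] k \<epsilon> by auto
  then show "\<exists>x. \<exists>\<phi>\<in>cball 0 1. 1 - \<epsilon> < norm \<phi> \<and> (\<forall>i\<in>{1..k}. x i \<in> S i \<and> x i + \<phi> \<in> S i \<and> x i - \<phi> \<in> S i)"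
    by (intro exI[of _ "\<lambda>i. T (x i)"] bexI[of _ "T \<phi>"])
      (simp_all add: T(2) linear_add[OF T(1)] linear_diff[OF T(1)] dist_norm)
qed

section \<open>The dual of the Lipschitz-free space\<close>

lift_definition point :: "'a::pointed_metric_space \<Rightarrow> 'a lipfree" is delta
  by (rule closure_subset[THEN subsetD]) (simp add: span_base)

text \<open>The isometry of \<open>Lip\<^sub>0(M)\<close> onto the dual of the Lipschitz-free space.\<close>

lift_definition lip0_functional :: "'a::pointed_metric_space lip0 \<Rightarrow> 'a lipfree \<Rightarrow>\<^sub>L real"
  is "\<lambda>f \<mu>. dual_of_lipfree \<mu> f"
proof (rule bounded_linear_intro)
  fix f :: "'a lip0" and \<mu> \<nu> :: "'a lipfree" and r :: real
  show "dual_of_lipfree (\<mu> + \<nu>) f = dual_of_lipfree \<mu> f + dual_of_lipfree \<nu> f"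
    by (simp add: plus_lipfree.rep_eq blinfun.add_left)
  show "dual_of_lipfree (r *\<^sub>R \<mu>) f = r *\<^sub>R dual_of_lipfree \<mu> f"
    by (simp add: scaleR_lipfree.rep_eq blinfun.scaleR_left)
  show "norm (dual_of_lipfree \<mu> f) \<le> norm \<mu> * norm f"
    using norm_blinfun[of "dual_of_lipfree \<mu>" f] by (simp add: norm_lipfree.rep_eq)
qed

lemma lip0_functional_point: "lip0_functional f (point x) = apply_lip0 f x"
  by (simp add: lip0_functional.rep_eq point.rep_eq delta.rep_eq)

lemma norm_point_diff: "norm (point x - point y) \<le> dist x y"
proof -
  have "norm (delta x - delta y) \<le> dist x y"
    using apply_lip0_diff_le by (intro norm_blinfun_bound) (simp_all add: blinfun.diff_left delta.rep_eq mult.commute)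
  then show ?thesis by (simp add: norm_lipfree.rep_eq minus_lipfree.rep_eq point.rep_eq)
qed

lemma blinfun_point_lipschitz:
  fixes w :: "'a::pointed_metric_space lipfree \<Rightarrow>\<^sub>L real"
  shows "\<bar>w (point x) - w (point y)\<bar> \<le> norm w * dist x y"
proof -
  have "\<bar>w (point x) - w (point y)\<bar> = norm (w (point x - point y))" by (simp add: blinfun.diff_right)
  also have "\<dots> \<le> norm w * norm (point x - point y)" by (rule norm_blinfun)
  also have "\<dots> \<le> norm w * dist x y" by (intro mult_left_mono norm_point_diff) simp
  finally show ?thesis .
qed

lemma linear_lip0_functional: "linear lip0_functional"
  by (intro linearI blinfun_eqI)
    (simp_all add: lip0_functional.rep_eq blinfun.add_left blinfun.add_right blinfun.scaleR_left blinfun.scaleR_right)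

lemma norm_lip0_functional: "norm (lip0_functional f) = norm f"
proof (rule antisym)
  show "norm (lip0_functional f) \<le> norm f"
  proof (rule norm_blinfun_bound)
    fix \<mu> show "norm (lip0_functional f \<mu>) \<le> norm f * norm \<mu>"
      using norm_blinfun[of "dual_of_lipfree \<mu>" f]
      by (simp add: lip0_functional.rep_eq norm_lipfree.rep_eq mult.commute)
  qed simp
  show "norm f \<le> norm (lip0_functional f)"
    using blinfun_point_lipschitz[of "lip0_functional f"]
    by (intro norm_lip0_le) (simp_all add: lip0_functional_point)
qed

lemma span_points_dense:
  fixes \<mu> :: "'a::pointed_metric_space lipfree"
  obtains \<mu>s where "\<And>n. \<mu>s n \<in> span (range point)" "\<mu>s \<longlonglongrightarrow> \<mu>"
proof -
  have lin: "linear (dual_of_lipfree :: 'a lipfree \<Rightarrow> _)"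
    by (intro linearI) (simp_all add: plus_lipfree.rep_eq scaleR_lipfree.rep_eq)
  have "range delta = dual_of_lipfree ` range (point :: 'a \<Rightarrow> _)"
    by (simp add: image_image point.rep_eq)
  then have span: "span (range delta) = dual_of_lipfree ` span (range (point :: 'a \<Rightarrow> _))"
    by (simp add: linear_span_image[OF lin])
  obtain v where v: "\<And>n. v n \<in> span (range delta)" "v \<longlonglongrightarrow> dual_of_lipfree \<mu>"
    using dual_of_lipfree[of \<mu>] unfolding closure_sequential by blast
  have "\<forall>n. \<exists>\<nu>. \<nu> \<in> span (range point) \<and> v n = dual_of_lipfree \<nu>" using v(1) unfolding span by blast
  then obtain \<mu>s where \<mu>s: "\<And>n. \<mu>s n \<in> span (range point)" "\<And>n. v n = dual_of_lipfree (\<mu>s n)" by metis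
  have "(\<lambda>n. norm (v n - dual_of_lipfree \<mu>)) \<longlonglongrightarrow> 0"
    using v(2) by (simp add: LIM_zero tendsto_norm_zero)
  then have "(\<lambda>n. norm (\<mu>s n - \<mu>)) \<longlonglongrightarrow> 0"
    by (simp add: \<mu>s(2) norm_lipfree.rep_eq minus_lipfree.rep_eq)
  then have "\<mu>s \<longlonglongrightarrow> \<mu>" by (simp add: LIM_zero_iff tendsto_norm_zero_iff)
  then show thesis using that \<mu>s(1) by blast
qed

text \<open>A functional \<open>w\<close> is represented by the function \<open>x \<mapsto> w (point x)\<close>: both agree on the points, hence on
  their span, which is dense.\<close>

lemma surj_lip0_functional: "surj (lip0_functional :: 'a::pointed_metric_space lip0 \<Rightarrow> _)"
proof (rule surjI)
  fix w :: "'a lipfree \<Rightarrow>\<^sub>L real"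
  define f where "f = lip0_of (\<lambda>x. w (point x))"
  have "dual_of_lipfree (point (origin :: 'a)) = 0"
    using apply_lip0 by (intro blinfun_eqI) (fastforce simp: point.rep_eq delta.rep_eq)
  then have "point (origin :: 'a) = 0" by (metis dual_of_lipfree_inject zero_lipfree.rep_eq)
  then have f: "lip0_functional f (point x) = w (point x)" for x
    by (simp add: f_def lip0_functional_point apply_lip0_of[OF blinfun_point_lipschitz norm_ge_zero])
  have "lip0_functional f \<mu> = w \<mu>" for \<mu>
  proof -
    obtain \<mu>s where \<mu>s: "\<And>n. \<mu>s n \<in> span (range point)" "\<mu>s \<longlonglongrightarrow> \<mu>" using span_points_dense by blast
    have "linear (blinfun_apply v)" for v :: "'a lipfree \<Rightarrow>\<^sub>L real"
      by (rule bounded_linear.linear[OF blinfun.bounded_linear_right])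
    note eq_on_span = linear_eq_on_span[OF this this _ \<mu>s(1)]
    have "lip0_functional f (\<mu>s n) = w (\<mu>s n)" for n
      by (rule eq_on_span) (auto simp: f)
    then have "(\<lambda>n. w (\<mu>s n)) \<longlonglongrightarrow> lip0_functional f \<mu>"
      using blinfun.tendsto[OF tendsto_const[of "lip0_functional f"] \<mu>s(2)] by simp
    moreover have "(\<lambda>n. w (\<mu>s n)) \<longlonglongrightarrow> w \<mu>" by (intro blinfun.tendsto tendsto_const \<mu>s(2))
    ultimately show ?thesis by (rule LIMSEQ_unique)
  qed
  then show "lip0_functional f = w" by (rule blinfun_eqI)
qed

theorem theorem2p2:
  assumes "\<not> bounded (UNIV :: 'a::{complete_space, pointed_metric_space} set)
    \<or> \<not> uniform_discrete (UNIV :: 'a set)"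
  shows "SSD2P TYPE('a lip0) \<and> octahedral TYPE(('a lipfree \<Rightarrow>\<^sub>L real) \<Rightarrow>\<^sub>L real)"
proof
  show lip0: "SSD2P TYPE('a lip0)" by (rule SSD2P_lip0[OF assms])
  obtain p z :: 'a where "p \<noteq> z" using disjoint_annuli[OF assms order_refl] by metis
  have lip: "\<bar>dist x p - dist y p\<bar> \<le> 1 * dist x y" for x y
    using dist_triangle[of x p y] dist_triangle[of y p x] by (simp add: dist_commute)
  have "apply_lip0 (lip0_of (\<lambda>x. dist x p)) z \<noteq> apply_lip0 (lip0_of (\<lambda>x. dist x p)) p"
    using \<open>p \<noteq> z\<close> by (simp add: apply_lip0_of[OF lip])
  then have "lip0_of (\<lambda>x. dist x p) \<noteq> 0" by (auto simp: zero_lip0.rep_eq)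
  then have "lip0_functional (lip0_of (\<lambda>x. dist x p)) \<noteq> 0"
    using norm_lip0_functional by (metis norm_eq_zero)
  moreover have "SSD2P TYPE('a lipfree \<Rightarrow>\<^sub>L real)"
    using lip0 linear_lip0_functional norm_lip0_functional surj_lip0_functional by (rule SSD2P_isometry)
  ultimately show "octahedral TYPE(('a lipfree \<Rightarrow>\<^sub>L real) \<Rightarrow>\<^sub>L real)"
    using evaluations_norm_dual by (intro SSD2P_imp_dual_octahedral)
qed

end
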